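(* Let $K$ be a self-similar compact subset of $\mathbb{R}^d$ satisfying the Open Set Condition. Let $s=\dim_{\mathcal H}(K)=\dim_{\mathcal P}(K)$. Then there exists $\mu\in\mathcal{P}(K)$ such that, for every $\alpha\in(0,s)$, $\dim_{\mathcal H}\big(E(\mu;\alpha)\big)=\dim_{\mathcal P}\big(E(\mu;\alpha)\big)=\alpha$.
   Context: A (non-empty) compact set $K\subset\mathbb{R}^d$ is self-similar if there are finitely many contractive similarity maps $S_1,\dots,S_m:\mathbb{R}^d\to\mathbb{R}^d$ such that $K=\bigcup_i S_i(K)$. It satisfies the Open Set Condition if there is an open, non-empty, bounded set $\mathcal{O}\subset\mathbb{R}^d$ with $S_i(\mathcal{O})\subset\mathcal{O}$ for all $i$ and $S_i(\mathcal{O})\cap S_j(\mathcal{O})=\varnothing$ for all $i\neq j$. For such $K$ the Hausdorff dimension $\dim_{\mathcal H}(K)$ and the packing dimension $\dim_{\mathcal P}(K)$ coincide (a known fact). $\mathcal{P}(K)$ is the set of Borel probability measures on $K$. For $\mu\in\mathcal{P}(K)$ and $x\in K$, $\underline{\dim}_{\rm loc}(\mu;x)=\liminf_{r\to 0}\frac{\log\mu(B(x,r))}{\log r}$ and $\overline{\dim}_{\rm loc}(\mu;x)=\limsup_{r\to 0}\frac{\log\mu(B(x,r))}{\log r}$ (with $\log 0=-\infty$), and $E(\mu;\alpha)=\{x\in K:\ \underline{\dim}_{\rm loc}(\mu;x)=\overline{\dim}_{\rm loc}(\mu;x)=\alpha\}$. *)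

theory Defs
  imports "HOL-Probability.Probability"
begin

section \<open>Self-similar sets\<close>

definition contractive_similarity :: "('a::metric_space \<Rightarrow> 'a) \<Rightarrow> bool" where
  "contractive_similarity f \<longleftrightarrow>
     (\<exists>c::real. 0 < c \<and> c < 1 \<and> (\<forall>x y. dist (f x) (f y) = c * dist x y))"

(* The finite family of maps is S 0, ..., S (m - 1). *)
definition self_similar_by :: "nat \<Rightarrow> (nat \<Rightarrow> 'a \<Rightarrow> 'a) \<Rightarrow> 'a::metric_space set \<Rightarrow> bool" where
  "self_similar_by m S K \<longleftrightarrow>
     compact K \<and> K \<noteq> {} \<and> (\<forall>i<m. contractive_similarity (S i)) \<and> K = (\<Union>i<m. S i ` K)"

definition open_set_condition :: "nat \<Rightarrow> (nat \<Rightarrow> 'a \<Rightarrow> 'a::metric_space) \<Rightarrow> bool" where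
  "open_set_condition m S \<longleftrightarrow>
     (\<exists>V. open V \<and> V \<noteq> {} \<and> bounded V \<and> (\<forall>i<m. S i ` V \<subseteq> V) \<and>
          (\<forall>i<m. \<forall>j<m. i \<noteq> j \<longrightarrow> S i ` V \<inter> S j ` V = {}))"

section \<open>Hausdorff dimension\<close>

(* diam(U)^t, with the usual conventions that the empty set contributes 0 and that
   diam(U)^0 = 1 for nonempty U; the case t = 0 is separate because 0 powr 0 = 0. *)
definition diam_pow :: "real \<Rightarrow> 'a::metric_space set \<Rightarrow> ennreal" where
  "diam_pow t U = (if U = {} then 0 else if t = 0 then 1 else ennreal (diameter U powr t))"

(* Boundedness is required explicitly since diameter is unspecified on unbounded sets. *)
definition hausdorff_premeasure :: "real \<Rightarrow> real \<Rightarrow> 'a::metric_space set \<Rightarrow> ennreal" where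
  "hausdorff_premeasure \<delta> t A =
     (INF U\<in>{U :: nat \<Rightarrow> 'a set. A \<subseteq> (\<Union>n. U n) \<and> (\<forall>n. bounded (U n) \<and> diameter (U n) \<le> \<delta>)}.
        \<Sum>n. diam_pow t (U n))"

definition hausdorff_measure :: "real \<Rightarrow> 'a::metric_space set \<Rightarrow> ennreal" where
  "hausdorff_measure t A = (SUP \<delta>\<in>{0<..}. hausdorff_premeasure \<delta> t A)"

definition hausdorff_dim :: "'a::metric_space set \<Rightarrow> ereal" where
  "hausdorff_dim A = (INF t\<in>{t. 0 \<le> t \<and> hausdorff_measure t A = 0}. ereal t)"

section \<open>Packing dimension\<close>

(* A packing is a countable family of pairwise disjoint closed balls centred in A,
   encoded by its set of (centre, radius) pairs. *)
definition packings :: "real \<Rightarrow> 'a::metric_space set \<Rightarrow> ('a \<times> real) set set" where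
  "packings \<delta> A =
     {F. countable F \<and> F \<subseteq> A \<times> {0<..\<delta>} \<and> disjoint_family_on (\<lambda>(x, r). cball x r) F}"

(* 2 * r is the diameter of a ball of radius r in R^d, d >= 1. *)
definition packing_pre :: "real \<Rightarrow> real \<Rightarrow> 'a::metric_space set \<Rightarrow> ennreal" where
  "packing_pre \<delta> t A = (SUP F\<in>packings \<delta> A. \<Sum>\<^sub>\<infinity>(x, r)\<in>F. ennreal ((2 * r) powr t))"

definition packing_premeasure :: "real \<Rightarrow> 'a::metric_space set \<Rightarrow> ennreal" where
  "packing_premeasure t A = (INF \<delta>\<in>{0<..}. packing_pre \<delta> t A)"

(* The premeasure is not countably subadditive, whence the extra infimum. *)
definition packing_measure :: "real \<Rightarrow> 'a::metric_space set \<Rightarrow> ennreal" where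
  "packing_measure t A =
     (INF U\<in>{U :: nat \<Rightarrow> 'a set. A \<subseteq> (\<Union>n. U n)}. \<Sum>n. packing_premeasure t (U n))"

definition packing_dim :: "'a::metric_space set \<Rightarrow> ereal" where
  "packing_dim A = (INF t\<in>{t. 0 \<le> t \<and> packing_measure t A = 0}. ereal t)"

section \<open>Local dimensions of measures\<close>

(* Logarithm on [0, infinity) with log 0 = -infinity. *)
definition ext_ln :: "real \<Rightarrow> ereal" where
  "ext_ln x = (if x = 0 then -\<infinity> else ereal (ln x))"

definition borel_prob_measures :: "'a::metric_space set \<Rightarrow> 'a measure set" where
  "borel_prob_measures K = space (prob_algebra (restrict_space borel K))"

(* Measures in borel_prob_measures K have underlying space K,
   so cball x r \<inter> space \<mu> is the trace on K of the ball. *)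
definition lower_local_dim :: "'a::metric_space measure \<Rightarrow> 'a \<Rightarrow> ereal" where
  "lower_local_dim \<mu> x =
     Liminf (at_right 0) (\<lambda>r. ext_ln (measure \<mu> (cball x r \<inter> space \<mu>)) / ereal (ln r))"

definition upper_local_dim :: "'a::metric_space measure \<Rightarrow> 'a \<Rightarrow> ereal" where
  "upper_local_dim \<mu> x =
     Limsup (at_right 0) (\<lambda>r. ext_ln (measure \<mu> (cball x r \<inter> space \<mu>)) / ereal (ln r))"

definition local_dim_level_set :: "'a::metric_space measure \<Rightarrow> real \<Rightarrow> 'a set" where
  "local_dim_level_set \<mu> \<alpha> =
     {x \<in> space \<mu>. lower_local_dim \<mu> x = ereal \<alpha> \<and> upper_local_dim \<mu> x = ereal \<alpha>}"

end

theory Submission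
  imports Defs "HOL-Library.Discrete_Functions" "HOL-Real_Asymp.Real_Asymp"
begin

text \<open>
  If every point of a set \<open>A\<close> has \<open>\<mu>\<close>-mass at least \<open>r powr (\<alpha> + \<epsilon>)\<close> in all small balls of radius \<open>r\<close>,
  then \<open>A\<close> has packing dimension at most \<open>\<alpha>\<close>. Conversely, for a Frostman measure \<open>\<nu>\<close> of exponent
  \<open>\<alpha>\<close> and any finite \<open>\<mu>\<close>, Vitali's covering lemma shows that \<open>\<mu>\<close>-mass is at most
  \<open>r powr (\<alpha> - \<epsilon>)\<close> at \<open>\<nu>\<close>-almost every point. So it suffices to find one \<open>\<mu>\<close> that has, for every
  \<open>\<alpha>\<close>, the lower mass bound almost everywhere for some Frostman measure of exponent \<open>\<alpha>\<close>.

  For \<open>N\<close> maps of common ratio \<open>\<rho> = N powr (- 1 / \<sigma>)\<close>, let \<open>\<nu>\<close> choose the digits in positions \<open>k\<close> with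
  \<open>phase k < \<alpha> / \<sigma>\<close> uniformly and set all other digits to \<open>0\<close>, where \<open>phase\<close> is an equidistributed
  sequence. Among the first \<open>n\<close> positions these sets of free positions form a chain as \<open>\<alpha>\<close> varies, so
  there are at most \<open>n + 1\<close> of them. Hence an atomic \<open>\<mu>\<close> can give all the associated words of length
  \<open>n\<close> their \<open>\<nu>\<close>-mass up to a factor polynomial in \<open>n\<close>.

  In a general system with \<open>\<Sum>i. c i powr s = 1\<close>, the words of length \<open>n\<close> have only polynomially many
  different ratios, so by pigeonhole some homogeneous subsystem of these words has similarity
  dimension as close to \<open>s\<close> as desired; a countable mixture of the corresponding measures works for
  all \<open>\<alpha> < s\<close>.
\<close>

subsection \<open>Local dimensions as mass bounds\<close>

text \<open>A lower bound on mass is an upper bound on local dimension: dividing by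
  \<open>ln r < 0\<close> reverses the inequality.\<close>

definition lower_mass_bound :: "'a::metric_space measure \<Rightarrow> real \<Rightarrow> 'a \<Rightarrow> bool" where
  "lower_mass_bound \<mu> \<alpha> x \<longleftrightarrow>
     (\<forall>\<epsilon>>0. \<forall>\<^sub>F r in at_right 0. r powr (\<alpha> + \<epsilon>) \<le> measure \<mu> (cball x r))"

definition upper_mass_bound :: "'a::metric_space measure \<Rightarrow> real \<Rightarrow> 'a \<Rightarrow> bool" where
  "upper_mass_bound \<mu> \<alpha> x \<longleftrightarrow>
     (\<forall>\<epsilon>>0. \<forall>\<^sub>F r in at_right 0. measure \<mu> (cball x r) \<le> r powr (\<alpha> - \<epsilon>))"

text \<open>Every exponent below \<open>\<alpha>\<close> is asked for, with \<open>C\<close>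
  depending on \<open>t\<close>: the measures built later are controlled only up to subexponential
  factors.\<close>

definition frostman :: "'a::metric_space measure \<Rightarrow> real \<Rightarrow> bool" where
  "frostman \<nu> \<alpha> \<longleftrightarrow> prob_space \<nu> \<and> sets \<nu> = sets borel \<and>
     (\<forall>t. 0 < t \<and> t < \<alpha> \<longrightarrow>
        (\<exists>C. \<forall>x r. 0 < r \<and> r \<le> 1 \<longrightarrow> measure \<nu> (cball x r) \<le> C * r powr t))"

lemma le_mult_INF:
  fixes f :: "'b \<Rightarrow> ennreal"
  assumes "c > 0" "\<And>i. i \<in> I \<Longrightarrow> x \<le> ennreal c * f i"
  shows "x \<le> ennreal c * (INF i\<in>I. f i)"
proof -
  have c: "ennreal c * ennreal (1 / c) = 1" using \<open>c > 0\<close> by (simp flip: ennreal_mult)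
  have "ennreal (1 / c) * x \<le> f i" if "i \<in> I" for i
  proof -
    have "ennreal (1 / c) * x \<le> ennreal (1 / c) * (ennreal c * f i)"
      using assms that by (intro mult_left_mono) auto
    also have "\<dots> = ennreal c * ennreal (1 / c) * f i" by (simp only: mult_ac)
    finally show ?thesis using c by simp
  qed
  then have "ennreal (1 / c) * x \<le> (INF i\<in>I. f i)" by (rule INF_greatest)
  then have "ennreal c * (ennreal (1 / c) * x) \<le> ennreal c * (INF i\<in>I. f i)"
    by (rule mult_left_mono) simp
  also have "ennreal c * (ennreal (1 / c) * x) = x" using c by (simp only: mult.assoc[symmetric] mult_1)
  finally show ?thesis .
qed

lemma at_right_0_less_1: "\<forall>\<^sub>F r in at_right 0. 0 < r \<and> r < (1::real)"
  by (auto simp: eventually_at_right_field intro!: exI[of _ 1])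

lemma ext_ln_quotient_bounds:
  assumes "0 < r" "r < 1" "0 \<le> M"
  shows "ext_ln M / ereal (ln r) \<le> ereal t \<longleftrightarrow> r powr t \<le> M"
    and "ereal t \<le> ext_ln M / ereal (ln r) \<longleftrightarrow> M \<le> r powr t"
proof -
  have l: "ln r < 0" using assms by simp
  \<comment> \<open>For \<open>M = 0\<close> the quotient is \<open>-\<infinity>\<close> over a
    negative number, hence \<open>\<infinity>\<close>, which agrees with
    \<open>r powr t > 0\<close>.\<close>
  have *: "ext_ln M / ereal (ln r) = (if M = 0 then \<infinity> else ereal (ln M / ln r))"
    using l by (auto simp: ext_ln_def divide_ereal_def field_simps)
  have p: "r powr t > 0" using assms by simp
  have 1: "ln M / ln r \<le> t \<longleftrightarrow> r powr t \<le> M" if "M > 0"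
  proof -
    have "ln M / ln r \<le> t \<longleftrightarrow> ln (r powr t) \<le> ln M"
      using l assms by (simp add: neg_divide_le_eq ln_powr)
    also have "\<dots> \<longleftrightarrow> r powr t \<le> M" using p that by (rule ln_le_cancel_iff)
    finally show ?thesis .
  qed
  have 2: "t \<le> ln M / ln r \<longleftrightarrow> M \<le> r powr t" if "M > 0"
  proof -
    have "t \<le> ln M / ln r \<longleftrightarrow> ln M \<le> ln (r powr t)"
      using l assms by (simp add: neg_le_divide_eq ln_powr)
    also have "\<dots> \<longleftrightarrow> M \<le> r powr t" using that p by (rule ln_le_cancel_iff)
    finally show ?thesis .
  qed
  show "ext_ln M / ereal (ln r) \<le> ereal t \<longleftrightarrow> r powr t \<le> M"
    using * 1 p assms by (auto split: if_splits)
  show "ereal t \<le> ext_ln M / ereal (ln r) \<longleftrightarrow> M \<le> r powr t"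
    using * 2 p assms by (auto split: if_splits)
qed

lemma upper_local_dim_le_iff:
  "upper_local_dim \<mu> x \<le> ereal \<alpha> \<longleftrightarrow>
     (\<forall>\<epsilon>>0. \<forall>\<^sub>F r in at_right 0. r powr (\<alpha> + \<epsilon>) \<le> measure \<mu> (cball x r \<inter> space \<mu>))"
    (is "?L \<longleftrightarrow> ?R")
proof
  assume ?L
  show ?R
  proof (intro allI impI)
    fix \<epsilon> :: real assume "\<epsilon> > 0"
    then have "ereal \<alpha> < ereal (\<alpha> + \<epsilon>)" by simp
    with \<open>?L\<close> have "\<forall>\<^sub>F r in at_right 0.
        ext_ln (measure \<mu> (cball x r \<inter> space \<mu>)) / ereal (ln r) < ereal (\<alpha> + \<epsilon>)"
      unfolding upper_local_dim_def Limsup_le_iff by blast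
    then show "\<forall>\<^sub>F r in at_right 0. r powr (\<alpha> + \<epsilon>) \<le> measure \<mu> (cball x r \<inter> space \<mu>)"
      using at_right_0_less_1
    proof eventually_elim
      case (elim r)
      then show ?case
        by (subst ext_ln_quotient_bounds(1)[symmetric]) (auto simp: measure_nonneg)
    qed
  qed
next
  assume R: ?R
  show ?L unfolding upper_local_dim_def Limsup_le_iff
  proof (intro allI impI)
    fix y :: ereal assume "ereal \<alpha> < y"
    \<comment> \<open>A real \<open>z\<close> strictly below \<open>y\<close> turns the non-strict
      mass bound into the strict inequality of the Limsup characterisation, also when
      \<open>y = \<infinity>\<close>.\<close>
    then obtain z where z: "\<alpha> < z" "ereal z < y" using ereal_dense2 by fastforce
    have "\<forall>\<^sub>F r in at_right 0. r powr (\<alpha> + (z - \<alpha>)) \<le> measure \<mu> (cball x r \<inter> space \<mu>)"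
      using R z by (metis diff_gt_0_iff_gt)
    then show "\<forall>\<^sub>F r in at_right 0. ext_ln (measure \<mu> (cball x r \<inter> space \<mu>)) / ereal (ln r) < y"
      using at_right_0_less_1
    proof eventually_elim
      case (elim r)
      then have "ext_ln (measure \<mu> (cball x r \<inter> space \<mu>)) / ereal (ln r) \<le> ereal z"
        by (subst ext_ln_quotient_bounds(1)) (auto simp: measure_nonneg)
      then show ?case using z(2) by (rule le_less_trans)
    qed
  qed
qed

lemma le_lower_local_dim_iff:
  "ereal \<alpha> \<le> lower_local_dim \<mu> x \<longleftrightarrow>
     (\<forall>\<epsilon>>0. \<forall>\<^sub>F r in at_right 0. measure \<mu> (cball x r \<inter> space \<mu>) \<le> r powr (\<alpha> - \<epsilon>))"
    (is "?L \<longleftrightarrow> ?R")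
proof
  assume ?L
  show ?R
  proof (intro allI impI)
    fix \<epsilon> :: real assume "\<epsilon> > 0"
    then have "ereal (\<alpha> - \<epsilon>) < ereal \<alpha>" by simp
    with \<open>?L\<close> have "\<forall>\<^sub>F r in at_right 0.
        ereal (\<alpha> - \<epsilon>) < ext_ln (measure \<mu> (cball x r \<inter> space \<mu>)) / ereal (ln r)"
      unfolding lower_local_dim_def le_Liminf_iff by blast
    then show "\<forall>\<^sub>F r in at_right 0. measure \<mu> (cball x r \<inter> space \<mu>) \<le> r powr (\<alpha> - \<epsilon>)"
      using at_right_0_less_1
    proof eventually_elim
      case (elim r)
      then show ?case
        by (subst ext_ln_quotient_bounds(2)[symmetric]) (auto simp: measure_nonneg)
    qed
  qed
next
  assume R: ?R
  show ?L unfolding lower_local_dim_def le_Liminf_iff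
  proof (intro allI impI)
    fix y :: ereal assume "y < ereal \<alpha>"
    then obtain z where z: "z < \<alpha>" "y < ereal z" using ereal_dense2 by fastforce
    have "\<forall>\<^sub>F r in at_right 0. measure \<mu> (cball x r \<inter> space \<mu>) \<le> r powr (\<alpha> - (\<alpha> - z))"
      using R z by (metis diff_gt_0_iff_gt)
    then show "\<forall>\<^sub>F r in at_right 0. y < ext_ln (measure \<mu> (cball x r \<inter> space \<mu>)) / ereal (ln r)"
      using at_right_0_less_1
    proof eventually_elim
      case (elim r)
      then have "ereal z \<le> ext_ln (measure \<mu> (cball x r \<inter> space \<mu>)) / ereal (ln r)"
        by (subst ext_ln_quotient_bounds(2)) (auto simp: measure_nonneg)
      then show ?case using z(2) by (rule less_le_trans[rotated])
    qed
  qed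
qed

text \<open>Liminf never exceeds Limsup, so each equality reduces to one inequality. The primed
  measure is meant to live on the whole space, and \<open>\<mu>\<close> to be its restriction to a
  carrier.\<close>

lemma local_dim_level_set_eq:
  assumes "\<And>x r. measure \<mu> (cball x r \<inter> space \<mu>) = measure \<mu>' (cball x r)"
  shows "local_dim_level_set \<mu> \<alpha> =
    {x \<in> space \<mu>. lower_mass_bound \<mu>' \<alpha> x \<and> upper_mass_bound \<mu>' \<alpha> x}"
proof -
  have "lower_local_dim \<mu> x = ereal \<alpha> \<and> upper_local_dim \<mu> x = ereal \<alpha> \<longleftrightarrow>
     upper_local_dim \<mu> x \<le> ereal \<alpha> \<and> ereal \<alpha> \<le> lower_local_dim \<mu> x" for x
  proof -
    have "lower_local_dim \<mu> x \<le> upper_local_dim \<mu> x"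
      unfolding lower_local_dim_def upper_local_dim_def by (intro Liminf_le_Limsup) simp
    then show ?thesis by auto
  qed
  then show ?thesis
    unfolding local_dim_level_set_def upper_local_dim_le_iff le_lower_local_dim_iff
      lower_mass_bound_def upper_mass_bound_def assms by blast
qed

subsection \<open>Packing dimension\<close>

text \<open>Each \<open>(2 * r) powr t'\<close> is at most
  \<open>2 powr t' * \<delta> powr (t' - t)\<close> times the mass of its ball, and the masses of
  disjoint balls add up to at most the total mass.\<close>

lemma packing_pre_le_measure:
  fixes \<mu> :: "'a::metric_space measure"
  assumes \<mu>: "finite_measure \<mu>" "sets \<mu> = sets borel"
    and "0 < \<delta>" "\<delta> \<le> h" "t < t'" "0 < t'"
    and A: "\<And>x r. x \<in> A \<Longrightarrow> 0 < r \<Longrightarrow> r \<le> h \<Longrightarrow> r powr t \<le> measure \<mu> (cball x r)"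
  shows "packing_pre \<delta> t' A \<le> ennreal (2 powr t' * measure \<mu> (space \<mu>) * \<delta> powr (t' - t))"
  unfolding packing_pre_def
proof (intro SUP_least)
  interpret finite_measure \<mu> by fact
  fix F assume "F \<in> packings \<delta> A"
  then have F: "F \<subseteq> A \<times> {0<..\<delta>}" "disjoint_family_on (\<lambda>(x, r). cball x r) F"
    by (auto simp: packings_def)
  \<comment> \<open>Finite subfamilies suffice: a nonnegative infinite sum is the supremum of its
    finite partial sums.\<close>
  have "sum (\<lambda>(x, r). ennreal ((2 * r) powr t')) G
      \<le> ennreal (2 powr t' * measure \<mu> (space \<mu>) * \<delta> powr (t' - t))" if G: "finite G" "G \<subseteq> F" for G
  proof -
    have "(2 * r) powr t' \<le> 2 powr t' * \<delta> powr (t' - t) * measure \<mu> (cball x r)" if "(x, r) \<in> G" for x r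
    proof -
      have xr: "x \<in> A" "0 < r" "r \<le> \<delta>" using that G F by auto
      have "(2 * r) powr t' = 2 powr t' * r powr (t' - t) * r powr t"
        using xr by (simp add: powr_mult flip: powr_add)
      also have "\<dots> \<le> 2 powr t' * \<delta> powr (t' - t) * measure \<mu> (cball x r)"
        using xr assms by (intro mult_mono A powr_mono2) auto
      finally show ?thesis .
    qed
    then have "(\<Sum>(x, r)\<in>G. (2 * r) powr t') \<le>
        (\<Sum>p\<in>G. 2 powr t' * \<delta> powr (t' - t) * measure \<mu> (case p of (x, r) \<Rightarrow> cball x r))"
      by (intro sum_mono) auto
    also have "\<dots> = 2 powr t' * \<delta> powr (t' - t) * (\<Sum>p\<in>G. measure \<mu> (case p of (x, r) \<Rightarrow> cball x r))"
      by (simp add: sum_distrib_left)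
    also have "(\<Sum>p\<in>G. measure \<mu> (case p of (x, r) \<Rightarrow> cball x r)) =
        measure \<mu> (\<Union>p\<in>G. case p of (x, r) \<Rightarrow> cball x r)"
    proof (rule finite_measure_finite_Union[symmetric])
      show "disjoint_family_on (\<lambda>p. case p of (x, r) \<Rightarrow> cball x r) G"
        using F(2) G(2) by (rule disjoint_family_on_mono[rotated])
    qed (use G \<mu> in auto)
    also have "2 powr t' * \<delta> powr (t' - t) * \<dots> \<le> 2 powr t' * \<delta> powr (t' - t) * measure \<mu> (space \<mu>)"
      by (intro mult_left_mono bounded_measure) auto
    finally have "(\<Sum>(x, r)\<in>G. (2 * r) powr t') \<le> 2 powr t' * measure \<mu> (space \<mu>) * \<delta> powr (t' - t)"
      by (simp add: mult_ac)
    then show ?thesis by (auto simp: case_prod_unfold intro!: ennreal_leI)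
  qed
  then show "(\<Sum>\<^sub>\<infinity>(x, r)\<in>F. ennreal ((2 * r) powr t'))
      \<le> ennreal (2 powr t' * measure \<mu> (space \<mu>) * \<delta> powr (t' - t))"
    by (subst nonneg_infsum_complete) (auto intro!: SUP_least)
qed

text \<open>The scale below which the mass bound holds depends on the point. Sorting the points by
  that scale gives countably many pieces with a uniform bound, and on each the premeasure vanishes
  as \<delta> tends to 0.\<close>

lemma packing_dim_le:
  fixes \<mu> :: "'a::metric_space measure"
  assumes \<mu>: "finite_measure \<mu>" "sets \<mu> = sets borel"
    and "0 \<le> \<alpha>" and A: "\<And>x. x \<in> A \<Longrightarrow> lower_mass_bound \<mu> \<alpha> x"
  shows "packing_dim A \<le> ereal \<alpha>"
proof (rule ereal_le_epsilon2)
  fix e :: real assume "0 < e"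
  \<comment> \<open>The gap between \<open>\<alpha>\<close> and \<open>t\<close> is the slack of the
    mass bound; the gap between \<open>t\<close> and \<open>t'\<close> makes
    \<open>\<delta> powr (t' - t)\<close> tend to 0.\<close>
  define t where "t = \<alpha> + e / 2"
  define t' where "t' = \<alpha> + e"
  have t: "t < t'" "0 < t'" using \<open>e > 0\<close> assms by (auto simp: t_def t'_def)
  define U where "U n = {x \<in> A. \<forall>r. 0 < r \<and> r \<le> 1 / real (Suc n) \<longrightarrow> r powr t \<le> measure \<mu> (cball x r)}" for n
  have "A \<subseteq> (\<Union>n. U n)"
  proof
    fix x assume x: "x \<in> A"
    have "\<forall>\<^sub>F r in at_right 0. r powr t \<le> measure \<mu> (cball x r)"
      using A[OF x] \<open>e > 0\<close> by (auto simp: lower_mass_bound_def t_def)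
    then obtain b where b: "b > 0" "\<And>r. 0 < r \<Longrightarrow> r < b \<Longrightarrow> r powr t \<le> measure \<mu> (cball x r)"
      by (auto simp: eventually_at_right_field)
    obtain n where "1 / real (Suc n) < b" using b(1) nat_approx_posE by (metis of_nat_Suc)
    then show "x \<in> (\<Union>n. U n)" using b x by (auto simp: U_def intro!: exI[of _ n])
  qed
  have "packing_premeasure t' (U n) = 0" for n
  proof -
    define c where "c = 2 powr t' * measure \<mu> (space \<mu>)"
    have "packing_premeasure t' (U n) \<le> ennreal (c * \<delta> powr (t' - t))" if "0 < \<delta>" "\<delta> \<le> 1 / real (Suc n)" for \<delta>
    proof -
      have "packing_premeasure t' (U n) \<le> packing_pre \<delta> t' (U n)"
        unfolding packing_premeasure_def using that by (intro INF_lower) auto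
      also have "\<dots> \<le> ennreal (c * \<delta> powr (t' - t))"
        unfolding c_def using that t by (intro packing_pre_le_measure[OF \<mu>]) (auto simp: U_def)
      finally show ?thesis .
    qed
    then have "\<forall>\<^sub>F \<delta> in at_right 0. packing_premeasure t' (U n) \<le> ennreal (c * \<delta> powr (t' - t))"
      by (intro eventually_at_rightI[of 0 "1 / real (Suc n)"]) auto
    moreover have "((\<lambda>\<delta>. ennreal (c * \<delta> powr (t' - t))) \<longlongrightarrow> ennreal (c * 0)) (at_right 0)"
    proof (intro tendsto_ennrealI tendsto_mult tendsto_const)
      have "((\<lambda>\<delta>::real. \<delta> powr (t' - t)) \<longlongrightarrow> 0 powr (t' - t)) (at_right 0)"
        using t by (intro tendsto_powr') (auto intro!: eventually_at_rightI[of 0 1])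
      then show "((\<lambda>\<delta>::real. \<delta> powr (t' - t)) \<longlongrightarrow> 0) (at_right 0)" by simp
    qed
    ultimately have "packing_premeasure t' (U n) \<le> ennreal (c * 0)"
      by (intro tendsto_lowerbound) auto
    then show ?thesis by simp
  qed
  then have "(\<Sum>n. packing_premeasure t' (U n)) = 0" by simp
  then have "packing_measure t' A \<le> 0"
    unfolding packing_measure_def using \<open>A \<subseteq> _\<close> by (intro INF_lower2[of U]) auto
  then have "packing_dim A \<le> ereal t'"
    unfolding packing_dim_def using t by (intro INF_lower) auto
  then show "packing_dim A \<le> ereal \<alpha> + ereal e" by (simp add: t'_def)
qed

subsection \<open>Hausdorff dimension\<close>

lemma hausdorff_premeasure_le_finite_cover:
  assumes "finite F" "A \<subseteq> (\<Union>x\<in>F. B x)" "0 \<le> \<delta>"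
    and B: "\<And>x. x \<in> F \<Longrightarrow> bounded (B x) \<and> diameter (B x) \<le> \<delta>"
  shows "hausdorff_premeasure \<delta> t A \<le> (\<Sum>x\<in>F. diam_pow t (B x))"
proof -
  obtain h where h: "bij_betw h {..<card F} F"
    using ex_bij_betw_nat_finite[OF assms(1)] by (auto simp: atLeast0LessThan)
  \<comment> \<open>Padding with empty sets is free even for \<open>t = 0\<close>, by the convention
    in \<open>diam_pow\<close>.\<close>
  define U where "U n = (if n < card F then B (h n) else {})" for n
  have hF: "h n \<in> F" if "n < card F" for n using h that by (auto simp: bij_betw_def)
  have "A \<subseteq> (\<Union>n. U n)"
  proof
    fix x assume "x \<in> A"
    then obtain y where "y \<in> F" "x \<in> B y" using assms by auto
    moreover from \<open>y \<in> F\<close> obtain n where "n < card F" "h n = y"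
      using h by (force simp: bij_betw_def)
    ultimately show "x \<in> (\<Union>n. U n)" by (auto simp: U_def intro!: exI[of _ n])
  qed
  moreover have "bounded (U n) \<and> diameter (U n) \<le> \<delta>" for n
    using B hF assms by (auto simp: U_def)
  ultimately have "hausdorff_premeasure \<delta> t A \<le> (\<Sum>n. diam_pow t (U n))"
    unfolding hausdorff_premeasure_def by (intro INF_lower) auto
  also have "\<dots> = (\<Sum>n<card F. diam_pow t (U n))"
    by (intro suminf_finite) (auto simp: U_def diam_pow_def)
  also have "\<dots> = (\<Sum>n<card F. diam_pow t (B (h n)))"
    by (simp add: U_def)
  also have "\<dots> = (\<Sum>x\<in>F. diam_pow t (B x))"
    using h by (rule sum.reindex_bij_betw)
  finally show ?thesis .
qed

lemma hausdorff_premeasure_antimono: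
  "\<delta> \<le> \<delta>' \<Longrightarrow> hausdorff_premeasure \<delta>' t A \<le> hausdorff_premeasure \<delta> t A"
  unfolding hausdorff_premeasure_def by (intro INF_superset_mono) (auto intro: order_trans)

lemma hausdorff_premeasure_countable_subadditive:
  assumes "A \<subseteq> (\<Union>n. U n)"
  shows "hausdorff_premeasure \<delta> t A \<le> (\<Sum>n. hausdorff_premeasure \<delta> t (U n))"
proof (rule ennreal_le_epsilon)
  fix e :: real assume fin: "(\<Sum>n. hausdorff_premeasure \<delta> t (U n)) < top" and "0 < e"
  define e' where "e' n = ennreal (e * (1/2) ^ Suc n)" for n
  have "\<exists>W. U n \<subseteq> (\<Union>k. W k) \<and> (\<forall>k. bounded (W k) \<and> diameter (W k) \<le> \<delta>) \<and>
        (\<Sum>k. diam_pow t (W k)) \<le> hausdorff_premeasure \<delta> t (U n) + e' n" for n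
  proof -
    \<comment> \<open>Finiteness makes adding the slack \<open>e' n\<close> a strict increase, so a
      near-optimal cover exists; the slacks sum to \<open>e\<close>.\<close>
    have "hausdorff_premeasure \<delta> t (U n) \<noteq> top"
    proof
      assume *: "hausdorff_premeasure \<delta> t (U n) = top"
      have "(\<Sum>k\<in>{n}. hausdorff_premeasure \<delta> t (U k)) \<le> (\<Sum>n. hausdorff_premeasure \<delta> t (U n))"
        by (rule sum_le_suminf) auto
      then show False using fin * by (simp add: top_unique)
    qed
    then have "hausdorff_premeasure \<delta> t (U n) < hausdorff_premeasure \<delta> t (U n) + e' n"
      using \<open>0 < e\<close> by (simp add: e'_def ennreal_add_left_cancel_less less_top)
    then show ?thesis
      by (subst (asm) (1) hausdorff_premeasure_def) (auto simp: INF_less_iff less_imp_le)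
  qed
  then obtain W where W: "\<And>n. U n \<subseteq> (\<Union>k. W n k)" "\<And>n k. bounded (W n k) \<and> diameter (W n k) \<le> \<delta>"
      "\<And>n. (\<Sum>k. diam_pow t (W n k)) \<le> hausdorff_premeasure \<delta> t (U n) + e' n"
    by metis
  define V where "V i = (case prod_decode i of (n, k) \<Rightarrow> W n k)" for i
  have "A \<subseteq> (\<Union>i. V i)"
  proof
    fix x assume "x \<in> A"
    then obtain n k where "x \<in> W n k" using assms W(1) by blast
    then show "x \<in> (\<Union>i. V i)" by (auto simp: V_def intro!: exI[of _ "prod_encode (n, k)"])
  qed
  then have "hausdorff_premeasure \<delta> t A \<le> (\<Sum>i. diam_pow t (V i))"
    unfolding hausdorff_premeasure_def using W(2) by (intro INF_lower) (auto simp: V_def split: prod.split)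
  also have "\<dots> = (\<Sum>n. \<Sum>k. diam_pow t (W n k))"
    using suminf_ennreal_2dimen[of "\<lambda>n. \<Sum>k. diam_pow t (W n k)" "\<lambda>(n, k). diam_pow t (W n k)"]
    by (simp add: V_def o_def case_prod_unfold)
  also have "\<dots> \<le> (\<Sum>n. hausdorff_premeasure \<delta> t (U n) + e' n)"
    using W(3) by (intro suminf_le) auto
  also have "\<dots> = (\<Sum>n. hausdorff_premeasure \<delta> t (U n)) + (\<Sum>n. e' n)"
    by (intro suminf_add[symmetric]) auto
  also have "(\<Sum>n. e' n) = ennreal e"
  proof -
    have "(\<lambda>n. e * (1/2) ^ Suc n) sums (e * 1)"
      by (intro sums_mult power_half_series)
    then show ?thesis unfolding e'_def using \<open>0 < e\<close> by (intro suminf_ennreal_eq) auto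
  qed
  finally show "hausdorff_premeasure \<delta> t A \<le> (\<Sum>n. hausdorff_premeasure \<delta> t (U n)) + ennreal e" .
qed

text \<open>Take a largest family of disjoint balls of radius \<open>\<delta>\<close> centred in
  \<open>A\<close>. The balls of doubled radius cover \<open>A\<close>, and
  \<open>(4 * \<delta>) powr t\<close> against \<open>(2 * \<delta>) powr t\<close> gives the factor
  \<open>2 powr t\<close>.\<close>

lemma hausdorff_premeasure_le_packing_pre:
  fixes A :: "'a::metric_space set"
  assumes "\<delta> > 0" "t \<ge> 0"
  shows "hausdorff_premeasure (4 * \<delta>) t A \<le> ennreal (2 powr t) * packing_pre \<delta> t A"
proof (cases "packing_pre \<delta> t A = top")
  case True
  then show ?thesis by (simp add: ennreal_mult_top)
next
  case False
  then obtain p where p: "packing_pre \<delta> t A = ennreal p" "p \<ge> 0" by (cases "packing_pre \<delta> t A") auto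
  define sep where "sep F \<longleftrightarrow> finite F \<and> F \<subseteq> A \<and> disjoint_family_on (\<lambda>x. cball x \<delta>) F" for F
  have bound: "real (card F) * (2 * \<delta>) powr t \<le> p" if "sep F" for F
  proof -
    let ?G = "(\<lambda>x. (x, \<delta>)) ` F"
    have "?G \<in> packings \<delta> A"
      using that \<open>\<delta> > 0\<close> by (auto simp: packings_def sep_def disjoint_family_on_def intro: countable_finite)
    then have "(\<Sum>\<^sub>\<infinity>(x, r)\<in>?G. ennreal ((2 * r) powr t)) \<le> ennreal p"
      unfolding p(1)[symmetric] packing_pre_def by (rule SUP_upper)
    also have "(\<Sum>\<^sub>\<infinity>(x, r)\<in>?G. ennreal ((2 * r) powr t)) = (\<Sum>x\<in>F. ennreal ((2 * \<delta>) powr t))"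
      using that by (subst infsum_finite) (auto simp: sep_def sum.reindex inj_on_def)
    also have "\<dots> = ennreal (real (card F) * (2 * \<delta>) powr t)"
      by (simp add: ennreal_mult ennreal_of_nat_eq_real_of_nat)
    finally show ?thesis using p by (simp add: ennreal_le_iff)
  qed
  have pos: "(2 * \<delta>) powr t > 0" using assms by simp
  \<comment> \<open>A finite packing sum bounds the size of disjoint families, so a largest one
    exists; any uncovered point could be added to it.\<close>
  have "card G < Suc (nat \<lceil>p / (2 * \<delta>) powr t\<rceil>)" if "sep G" for G
  proof -
    from bound[OF that] have "real (card G) \<le> p / (2 * \<delta>) powr t"
      using pos by (simp add: pos_le_divide_eq)
    then show ?thesis by linarith
  qed
  moreover have "sep {}" by (auto simp: sep_def disjoint_family_on_def)
  ultimately have "\<exists>F. sep F \<and> (\<forall>G. sep G \<longrightarrow> card G \<le> card F)"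
    by (intro ex_has_greatest_nat) auto
  then obtain F where F: "sep F" "\<And>G. sep G \<Longrightarrow> card G \<le> card F" by blast
  have cover: "A \<subseteq> (\<Union>x\<in>F. cball x (2 * \<delta>))"
  proof
    fix y assume y: "y \<in> A"
    show "y \<in> (\<Union>x\<in>F. cball x (2 * \<delta>))"
    proof (rule ccontr)
      assume *: "y \<notin> (\<Union>x\<in>F. cball x (2 * \<delta>))"
      have far: "dist x y > 2 * \<delta>" if "x \<in> F" for x using * that by (auto simp: not_le)
      then have "y \<notin> F" using \<open>\<delta> > 0\<close> by (metis dist_self mult_pos_pos not_less_iff_gr_or_eq zero_less_numeral)
      have dj: "cball x \<delta> \<inter> cball y \<delta> = {}" if "x \<in> F" for x
      proof -
        have False if "dist x z \<le> \<delta>" "dist y z \<le> \<delta>" for z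
          using that far[OF \<open>x \<in> F\<close>] dist_triangle[of x y z] by (simp add: dist_commute)
        then show ?thesis by auto
      qed
      have "sep (insert y F)"
        using F(1) y dj \<open>y \<notin> F\<close> unfolding sep_def
        by (auto simp: disjoint_family_on_insert)
      from F(2)[OF this] show False using F(1) \<open>y \<notin> F\<close> by (simp add: sep_def)
    qed
  qed
  have diam: "diameter (cball x (2 * \<delta>)) \<le> 4 * \<delta>" for x :: 'a
  proof -
    have "dist y z \<le> 4 * \<delta>" if "y \<in> cball x (2 * \<delta>)" "z \<in> cball x (2 * \<delta>)" for y z
      using that dist_triangle2[of y z x] by (simp add: dist_commute)
    then have "(\<lambda>(x,y). dist x y) ` (cball x (2 * \<delta>) \<times> cball x (2 * \<delta>)) \<subseteq> {..4 * \<delta>}"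
      by auto
    then show ?thesis unfolding diameter_def using assms
      by (auto intro!: cSUP_least)
  qed
  have "hausdorff_premeasure (4 * \<delta>) t A \<le> (\<Sum>x\<in>F. diam_pow t (cball x (2 * \<delta>)))"
    using F(1) cover assms diam by (intro hausdorff_premeasure_le_finite_cover) (auto simp: sep_def)
  also have "\<dots> \<le> (\<Sum>x\<in>F. ennreal ((4 * \<delta>) powr t))"
  proof (rule sum_mono)
    fix x :: 'a
    show "diam_pow t (cball x (2 * \<delta>)) \<le> ennreal ((4 * \<delta>) powr t)"
      using assms diam[of x] by (auto simp: diam_pow_def intro!: ennreal_leI powr_mono2 diameter_ge_0)
  qed
  also have "\<dots> = ennreal (real (card F) * (4 * \<delta>) powr t)"
    by (simp add: ennreal_mult ennreal_of_nat_eq_real_of_nat)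
  also have "real (card F) * (4 * \<delta>) powr t = 2 powr t * (real (card F) * (2 * \<delta>) powr t)"
  proof -
    have "(4 * \<delta>) powr t = 2 powr t * (2 * \<delta>) powr t"
      using powr_mult[of 2 "2 * \<delta>" t] by simp
    then show ?thesis by simp
  qed
  also have "ennreal \<dots> \<le> ennreal (2 powr t * p)"
    using bound[OF F(1)] by (intro ennreal_leI mult_left_mono) auto
  finally show ?thesis using p by (simp add: ennreal_mult)
qed

text \<open>Countable subadditivity of the Hausdorff premeasure carries the comparison through the
  infimum over covers in \<open>packing_measure\<close>.\<close>

lemma hausdorff_measure_le_packing_measure:
  fixes A :: "'a::metric_space set"
  assumes "t \<ge> 0"
  shows "hausdorff_measure t A \<le> ennreal (2 powr t) * packing_measure t A"
proof -
  have 1: "hausdorff_premeasure \<delta>0 t B \<le> ennreal (2 powr t) * packing_premeasure t B"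
    if "\<delta>0 > 0" for \<delta>0 and B :: "'a set"
  proof -
    have "hausdorff_premeasure \<delta>0 t B \<le> ennreal (2 powr t) * packing_pre \<delta> t B" if "\<delta> > 0" for \<delta>
    proof -
      \<comment> \<open>Two demands on \<open>\<delta>'\<close>: covering sets of diameter
        \<open>4 * \<delta>'\<close> must be admissible at scale \<open>\<delta>0\<close>, and
        packings at scale \<open>\<delta>'\<close> must be packings at scale
        \<open>\<delta>\<close>.\<close>
      define \<delta>' where "\<delta>' = min \<delta> (\<delta>0 / 4)"
      have \<delta>': "\<delta>' > 0" "4 * \<delta>' \<le> \<delta>0" "\<delta>' \<le> \<delta>" using that \<open>\<delta>0 > 0\<close> by (auto simp: \<delta>'_def)
      have "hausdorff_premeasure \<delta>0 t B \<le> hausdorff_premeasure (4 * \<delta>') t B"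
        by (rule hausdorff_premeasure_antimono) fact
      also have "\<dots> \<le> ennreal (2 powr t) * packing_pre \<delta>' t B"
        using \<delta>' assms by (intro hausdorff_premeasure_le_packing_pre)
      also have "packing_pre \<delta>' t B \<le> packing_pre \<delta> t B"
        unfolding packing_pre_def using \<delta>' by (intro SUP_subset_mono) (auto simp: packings_def)
      finally show ?thesis by (simp add: mult_left_mono)
    qed
    then show ?thesis unfolding packing_premeasure_def by (intro le_mult_INF) auto
  qed
  have "hausdorff_premeasure \<delta> t A \<le> ennreal (2 powr t) * (\<Sum>n. packing_premeasure t (U n))"
    if "\<delta> > 0" "A \<subseteq> (\<Union>n. U n)" for \<delta> U
  proof -
    have "hausdorff_premeasure \<delta> t A \<le> (\<Sum>n. hausdorff_premeasure \<delta> t (U n))"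
      using that(2) by (rule hausdorff_premeasure_countable_subadditive)
    also have "\<dots> \<le> (\<Sum>n. ennreal (2 powr t) * packing_premeasure t (U n))"
      using 1 that by (intro suminf_le) auto
    finally show ?thesis by simp
  qed
  then show ?thesis
    unfolding hausdorff_measure_def packing_measure_def by (intro SUP_least le_mult_INF) auto
qed

lemma hausdorff_dim_le_packing_dim: "hausdorff_dim A \<le> packing_dim A"
  unfolding hausdorff_dim_def packing_dim_def
proof (rule INF_superset_mono)
  show "{t. 0 \<le> t \<and> packing_measure t A = 0} \<subseteq> {t. 0 \<le> t \<and> hausdorff_measure t A = 0}"
  proof (rule Collect_mono, intro impI conjI)
    fix t assume t: "0 \<le> t \<and> packing_measure t A = 0"
    then have "hausdorff_measure t A \<le> ennreal (2 powr t) * 0"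
      using hausdorff_measure_le_packing_measure[of t A] by metis
    then show "hausdorff_measure t A = 0" by simp
  qed simp
qed auto

section \<open>Frostman measures and the mass distribution principle\<close>

lemma frostmanD:
  assumes "frostman \<nu> \<alpha>" "0 < t" "t < \<alpha>"
  obtains C where "C \<ge> 1" "\<And>x r. 0 < r \<Longrightarrow> measure \<nu> (cball x r) \<le> C * r powr t"
proof -
  interpret prob_space \<nu> using assms by (simp add: frostman_def)
  obtain C where C: "\<And>x r. 0 < r \<and> r \<le> 1 \<Longrightarrow> measure \<nu> (cball x r) \<le> C * r powr t"
    using assms unfolding frostman_def by meson
  have "measure \<nu> (cball x r) \<le> max 1 C * r powr t" if "0 < r" for x r
  proof (cases "r \<le> 1")
    case True
    then have "measure \<nu> (cball x r) \<le> C * r powr t" using C that by blast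
    also have "\<dots> \<le> max 1 C * r powr t" by (intro mult_right_mono) auto
    finally show ?thesis .
  next
    case False
    \<comment> \<open>For large radii the mass is at most 1 while \<open>r powr t\<close> is at
      least 1.\<close>
    have "measure \<nu> (cball x r) \<le> 1 * 1" by simp
    also have "\<dots> \<le> max 1 C * r powr t"
      using False assms by (intro mult_mono ge_one_powr_ge_zero) auto
    finally show ?thesis .
  qed
  then show ?thesis by (intro that[of "max 1 C"]) auto
qed

text \<open>A cover of \<open>A\<close> with \<open>diam_pow\<close> sum below
  \<open>1 / (2 * C)\<close> would lie in balls of total \<nu>-mass at most 1/2. Full mass is
  phrased through Borel supersets because \<open>A\<close> may be non-measurable.\<close>

theorem mass_distribution_principle:
  fixes A :: "'a::metric_space set"
  assumes \<nu>: "frostman \<nu> \<alpha>"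
    and A: "\<And>B. B \<in> sets borel \<Longrightarrow> A \<subseteq> B \<Longrightarrow> emeasure \<nu> B = 1"
  shows "ereal \<alpha> \<le> hausdorff_dim A"
  unfolding hausdorff_dim_def
proof (rule INF_greatest, rule ccontr)
  fix t assume t: "t \<in> {t. 0 \<le> t \<and> hausdorff_measure t A = 0}" and "\<not> ereal \<alpha> \<le> ereal t"
  then have "0 \<le> t" "t < \<alpha>" by auto
  interpret prob_space \<nu> using assms by (simp add: frostman_def)
  have sets: "sets \<nu> = sets borel" using assms by (simp add: frostman_def)
  obtain C where C: "C \<ge> 1"
      "\<And>x U. x \<in> U \<Longrightarrow> bounded U \<Longrightarrow> emeasure \<nu> (cball x (diameter U)) \<le> ennreal C * diam_pow t U"
  proof (cases "t = 0")
    case True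
    then show ?thesis
      by (intro that[of 1]) (auto simp: diam_pow_def emeasure_eq_measure ennreal_le_1)
  next
    case False
    with \<open>0 \<le> t\<close> have "0 < t" by simp
    then obtain C where C: "C \<ge> 1" "\<And>x r. 0 < r \<Longrightarrow> measure \<nu> (cball x r) \<le> C * r powr t"
      using frostmanD[OF \<nu> _ \<open>t < \<alpha>\<close>] by metis
    have "measure \<nu> (cball x r) \<le> C * r powr t" if "r \<ge> 0" for x r
    proof (cases "r = 0")
      case True
      \<comment> \<open>One-point covering sets have diameter 0, so radius 0 must be included;
        letting \<open>h\<close> tend to 0 shows that points carry no mass.\<close>
      have "measure \<nu> (cball x 0) \<le> C * h powr t" if "h > 0" for h
        using C(2)[OF that, of x] finite_measure_mono[of "cball x 0" "cball x h"] that sets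
        by (auto intro: order_trans)
      then have "\<forall>\<^sub>F h in at_right 0. measure \<nu> (cball x 0) \<le> C * h powr t"
        by (intro eventually_at_rightI[of 0 1]) auto
      moreover have "((\<lambda>h::real. C * h powr t) \<longlongrightarrow> C * 0 powr t) (at_right 0)"
        using \<open>0 < t\<close> by (intro tendsto_mult tendsto_const tendsto_powr') (auto intro!: eventually_at_rightI[of 0 1])
      ultimately have "measure \<nu> (cball x 0) \<le> C * 0 powr t"
        by (intro tendsto_lowerbound) auto
      then show ?thesis using True by simp
    qed (use C that in auto)
    then have "emeasure \<nu> (cball x (diameter U)) \<le> ennreal C * diam_pow t U"
      if "x \<in> U" "bounded U" for x U
      using that \<open>0 < t\<close> C(1)
      by (auto simp: diam_pow_def emeasure_eq_measure diameter_ge_0 simp flip: ennreal_mult intro!: ennreal_leI)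
    with C(1) show ?thesis by (rule that)
  qed
  \<comment> \<open>If the measure vanishes, so does the premeasure at every scale; scale 1 will do
    because the ball bound holds for all radii.\<close>
  have "hausdorff_premeasure 1 t A \<le> hausdorff_measure t A"
    unfolding hausdorff_measure_def by (intro SUP_upper) auto
  also have "\<dots> < ennreal (1 / (2 * C))" using t \<open>C \<ge> 1\<close> by simp
  finally obtain U :: "nat \<Rightarrow> 'a set" where U: "A \<subseteq> (\<Union>n. U n)" "\<And>n. bounded (U n)"
      "(\<Sum>n. diam_pow t (U n)) < ennreal (1 / (2 * C))"
    unfolding hausdorff_premeasure_def by (auto simp: INF_less_iff)
  \<comment> \<open>Closed balls replace the \<open>U n\<close>, which may be
    non-measurable.\<close>
  define B where "B n = (if U n = {} then {} else cball (SOME x. x \<in> U n) (diameter (U n)))" for n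
  have some: "(SOME x. x \<in> U n) \<in> U n" if "U n \<noteq> {}" for n using that by (simp add: some_in_eq)
  have UB: "U n \<subseteq> B n" for n
    using diameter_bounded_bound[OF U(2)] some by (fastforce simp: B_def)
  have "(\<Union>n. B n) \<in> sets borel" by (intro sets.countable_UN) (auto simp: B_def)
  then have "emeasure \<nu> (\<Union>n. B n) = 1"
    by (rule A) (use U(1) UB in blast)
  moreover have "range B \<subseteq> sets \<nu>" by (auto simp: B_def sets)
  ultimately have "1 \<le> (\<Sum>n. emeasure \<nu> (B n))"
    using emeasure_subadditive_countably[of B \<nu>] by simp
  also have "\<dots> \<le> (\<Sum>n. ennreal C * diam_pow t (U n))"
    using C some U(2) by (intro suminf_le) (auto simp: B_def)
  also have "\<dots> = ennreal C * (\<Sum>n. diam_pow t (U n))" by simp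
  also have "\<dots> \<le> ennreal C * ennreal (1 / (2 * C))"
    using U(3) by (intro mult_left_mono) auto
  also have "\<dots> = ennreal (1 / 2)" using \<open>C \<ge> 1\<close> by (simp flip: ennreal_mult)
  finally have "ennreal 1 \<le> ennreal (1 / 2)" by (simp only: ennreal_1)
  then show False by (subst (asm) ennreal_le_iff) auto
qed

section \<open>Small balls around Frostman-typical points\<close>

lemma emeasure_UN_countable_subadditive:
  assumes "countable I" "\<And>i. i \<in> I \<Longrightarrow> B i \<in> sets M"
  shows "emeasure M (\<Union>i\<in>I. B i) \<le> (\<integral>\<^sup>+i. emeasure M (B i) \<partial>count_space I)"
proof -
  have "emeasure M (\<Union>i\<in>I. B i) = (\<integral>\<^sup>+x. indicator (\<Union>i\<in>I. B i) x \<partial>M)"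
    using assms by (intro nn_integral_indicator[symmetric] sets.countable_UN') auto
  \<comment> \<open>The indicator of the union is dominated by the sum of the indicators; then sum
    and integral are exchanged.\<close>
  also have "\<dots> \<le> (\<integral>\<^sup>+x. \<integral>\<^sup>+i. indicator (B i) x \<partial>count_space I \<partial>M)"
  proof (rule nn_integral_mono)
    fix x
    show "indicator (\<Union>i\<in>I. B i) x \<le> (\<integral>\<^sup>+i. indicator (B i) x \<partial>count_space I)"
    proof (cases "x \<in> (\<Union>i\<in>I. B i)")
      case True
      then obtain j where j: "j \<in> I" "x \<in> B j" by auto
      have "(1::ennreal) = (\<integral>\<^sup>+i. indicator {j} i \<partial>count_space I)" using j by simp
      also have "\<dots> \<le> (\<integral>\<^sup>+i. indicator (B i) x \<partial>count_space I)"
        using j by (intro nn_integral_mono) (auto simp: indicator_def)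
      finally show ?thesis using True by simp
    qed simp
  qed
  also have "\<dots> = (\<integral>\<^sup>+i. \<integral>\<^sup>+x. indicator (B i) x \<partial>M \<partial>count_space I)"
    using assms by (intro nn_integral_count_space_nn_integral) auto
  also have "\<dots> = (\<integral>\<^sup>+i. emeasure M (B i) \<partial>count_space I)"
    using assms by (intro nn_integral_cong) auto
  finally show ?thesis .
qed

text \<open>Vitali's covering lemma bounds the \<open>\<nu>\<close>-size of the set of centres of small balls with too much
  \<open>\<mu>\<close>-mass.\<close>

lemma frostman_large_balls:
  fixes \<mu> \<nu> :: "'a::euclidean_space measure"
  assumes \<nu>: "frostman \<nu> \<alpha>" and \<mu>: "finite_measure \<mu>" "sets \<mu> = sets borel"
    and \<beta>: "0 < \<beta>" "\<beta> < \<alpha>"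
  shows "AE x in \<nu>. \<forall>\<^sub>F r in at_right 0. measure \<mu> (cball x r) \<le> r powr \<beta>"
proof -
  interpret \<nu>: prob_space \<nu> using assms by (simp add: frostman_def)
  interpret \<mu>: finite_measure \<mu> by fact
  have sets: "sets \<nu> = sets borel" using assms by (simp add: frostman_def)
  \<comment> \<open>Using the Frostman bound at an exponent strictly above \<open>\<beta>\<close>
    leaves a factor \<open>\<delta> powr (\<gamma> - \<beta>)\<close> that tends to 0.\<close>
  define \<gamma> where "\<gamma> = (\<alpha> + \<beta>) / 2"
  have \<gamma>: "\<beta> < \<gamma>" "\<gamma> < \<alpha>" "0 < \<gamma>" using \<beta> by (auto simp: \<gamma>_def)
  obtain C where C: "C \<ge> 1" "\<And>x r. 0 < r \<Longrightarrow> measure \<nu> (cball x r) \<le> C * r powr \<gamma>"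
    using frostmanD[OF \<nu> \<gamma>(3,2)] by metis
  \<comment> \<open>The factor \<open>5 powr \<gamma>\<close> pays for the enlargement of the balls
    in Vitali's lemma.\<close>
  define c where "c = C * 5 powr \<gamma> * measure \<mu> (space \<mu>)"
  define bad where "bad \<delta> = {x. \<exists>r. 0 < r \<and> r \<le> \<delta> \<and> measure \<mu> (cball x r) > r powr \<beta>}" for \<delta>
  \<comment> \<open>\<open>bad \<delta>\<close> may be non-measurable, so a measurable superset is
    produced: the enlarged balls, whose \<nu>-mass is compared with the \<mu>-mass of the disjoint
    ones.\<close>
  have "\<exists>G\<in>sets \<nu>. bad \<delta> \<subseteq> G \<and> emeasure \<nu> G \<le> ennreal (c * \<delta> powr (\<gamma> - \<beta>))" if "\<delta> > 0" for \<delta>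
  proof -
    obtain \<rho> where \<rho>: "\<And>x. x \<in> bad \<delta> \<Longrightarrow> 0 < \<rho> x \<and> \<rho> x \<le> \<delta> \<and> measure \<mu> (cball x (\<rho> x)) > \<rho> x powr \<beta>"
      using that[of "\<lambda>x. SOME r. 0 < r \<and> r \<le> \<delta> \<and> measure \<mu> (cball x r) > r powr \<beta>"]
      someI_ex[of "\<lambda>r. 0 < r \<and> r \<le> \<delta> \<and> measure \<mu> (cball x r) > r powr \<beta>" for x]
    unfolding bad_def by blast
    have "bad \<delta> \<subseteq> (\<Union>x\<in>bad \<delta>. cball x (\<rho> x))" using \<rho> by (force intro: less_imp_le)
    then obtain D where D: "countable D" "D \<subseteq> bad \<delta>"
       "pairwise (\<lambda>x y. disjnt (cball x (\<rho> x)) (cball y (\<rho> y))) D"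
       "bad \<delta> \<subseteq> (\<Union>x\<in>D. cball x (5 * \<rho> x))"
      by (rule Vitali_covering_lemma_cballs[of "bad \<delta>" "\<lambda>x. x" \<rho> "bad \<delta>" \<delta>]) (use \<rho> in auto)
    have disj: "disjoint_family_on (\<lambda>x. cball x (\<rho> x)) D"
      using D(3) by (auto simp: disjoint_family_on_def pairwise_def disjnt_def)
    have "emeasure \<nu> (\<Union>x\<in>D. cball x (5 * \<rho> x)) \<le> (\<integral>\<^sup>+x. emeasure \<nu> (cball x (5 * \<rho> x)) \<partial>count_space D)"
      using D(1) by (intro emeasure_UN_countable_subadditive) (auto simp: sets)
    also have "\<dots> \<le> (\<integral>\<^sup>+x. ennreal (C * 5 powr \<gamma> * \<delta> powr (\<gamma> - \<beta>)) * emeasure \<mu> (cball x (\<rho> x)) \<partial>count_space D)"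
    proof (rule nn_integral_mono)
      fix x assume "x \<in> space (count_space D)"
      then have x: "0 < \<rho> x" "\<rho> x \<le> \<delta>" "\<rho> x powr \<beta> < measure \<mu> (cball x (\<rho> x))" using \<rho> D(2) by auto
      have "measure \<nu> (cball x (5 * \<rho> x)) \<le> C * (5 * \<rho> x) powr \<gamma>" using C x by simp
      also have "\<dots> = C * 5 powr \<gamma> * \<rho> x powr (\<gamma> - \<beta>) * \<rho> x powr \<beta>"
        using x by (simp add: powr_mult flip: powr_add)
      also have "\<dots> \<le> C * 5 powr \<gamma> * \<delta> powr (\<gamma> - \<beta>) * measure \<mu> (cball x (\<rho> x))"
        using x C \<gamma> by (intro mult_mono powr_mono2) auto
      finally show "emeasure \<nu> (cball x (5 * \<rho> x)) \<le>
          ennreal (C * 5 powr \<gamma> * \<delta> powr (\<gamma> - \<beta>)) * emeasure \<mu> (cball x (\<rho> x))"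
        using C by (simp add: \<nu>.emeasure_eq_measure \<mu>.emeasure_eq_measure flip: ennreal_mult)
    qed
    also have "\<dots> = ennreal (C * 5 powr \<gamma> * \<delta> powr (\<gamma> - \<beta>)) * (\<integral>\<^sup>+x. emeasure \<mu> (cball x (\<rho> x)) \<partial>count_space D)"
      by (intro nn_integral_cmult) auto
    also have "(\<integral>\<^sup>+x. emeasure \<mu> (cball x (\<rho> x)) \<partial>count_space D) = emeasure \<mu> (\<Union>x\<in>D. cball x (\<rho> x))"
      using D(1) disj by (intro emeasure_UN_countable[symmetric]) (auto simp: \<mu>)
    also have "\<dots> \<le> ennreal (measure \<mu> (space \<mu>))"
      by (auto simp: \<mu>.emeasure_eq_measure \<mu>.bounded_measure)
    also have "ennreal (C * 5 powr \<gamma> * \<delta> powr (\<gamma> - \<beta>)) * ennreal (measure \<mu> (space \<mu>)) = ennreal (c * \<delta> powr (\<gamma> - \<beta>))"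
      using C by (simp add: c_def mult_ac flip: ennreal_mult)
    finally have "emeasure \<nu> (\<Union>x\<in>D. cball x (5 * \<rho> x)) \<le> ennreal (c * \<delta> powr (\<gamma> - \<beta>))"
      by (simp add: mult_left_mono)
    moreover have "(\<Union>x\<in>D. cball x (5 * \<rho> x)) \<in> sets \<nu>"
      using D(1) by (intro sets.countable_UN') (auto simp: sets)
    ultimately show ?thesis using D(4) by blast
  qed
  \<comment> \<open>A point violating the claim is bad at every scale, so it lies in all these
    supersets, and their intersection is null.\<close>
  then have "\<exists>G\<in>sets \<nu>. bad (1 / real (Suc n)) \<subseteq> G \<and> emeasure \<nu> G \<le> ennreal (c * (1 / real (Suc n)) powr (\<gamma> - \<beta>))" for n
    by simp
  then obtain G where G: "\<And>n. G n \<in> sets \<nu>" "\<And>n. bad (1 / real (Suc n)) \<subseteq> G n"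
     "\<And>n. emeasure \<nu> (G n) \<le> ennreal (c * (1 / real (Suc n)) powr (\<gamma> - \<beta>))"
    by metis
  have "(\<lambda>n. ennreal (c * (1 / real (Suc n)) powr (\<gamma> - \<beta>))) \<longlonglongrightarrow> ennreal (c * 0 powr (\<gamma> - \<beta>))"
    using \<gamma> by (intro tendsto_ennrealI tendsto_mult tendsto_const tendsto_powr' lim_1_over_n[THEN LIMSEQ_Suc]) auto
  moreover have "emeasure \<nu> (\<Inter>n. G n) \<le> ennreal (c * (1 / real (Suc n)) powr (\<gamma> - \<beta>))" for n
    using G(3)[of n] emeasure_mono[of "\<Inter>n. G n" "G n" \<nu>] G(1) by (auto intro: order_trans)
  ultimately have "emeasure \<nu> (\<Inter>n. G n) \<le> ennreal (c * 0 powr (\<gamma> - \<beta>))"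
    by (intro LIMSEQ_le_const) auto
  then have "(\<Inter>n. G n) \<in> null_sets \<nu>" using G(1) by (auto simp: null_sets_def)
  then show ?thesis
  proof (rule AE_I', intro subsetI, elim CollectE conjE)
    fix x assume *: "\<not> (\<forall>\<^sub>F r in at_right 0. measure \<mu> (cball x r) \<le> r powr \<beta>)"
    have "x \<in> bad (1 / real (Suc n))" for n
    proof (rule ccontr)
      assume nb: "x \<notin> bad (1 / real (Suc n))"
      have "measure \<mu> (cball x r) \<le> r powr \<beta>" if "0 < r" "r < 1 / real (Suc n)" for r
        using nb that less_imp_le[OF that(2)] unfolding bad_def mem_Collect_eq not_ex de_Morgan_conj not_less
        by (metis not_less)
      then have "\<forall>\<^sub>F r in at_right 0. measure \<mu> (cball x r) \<le> r powr \<beta>"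
        by (intro eventually_at_rightI[of 0 "1 / real (Suc n)"]) auto
      with * show False by blast
    qed
    then show "x \<in> (\<Inter>n. G n)" using G(2) by blast
  qed
qed

text \<open>Countably many exponents increasing to \<alpha> suffice, so only countably many null
  sets are united; \<open>n + 2\<close> keeps the exponents positive.\<close>

lemma frostman_AE_upper_mass_bound:
  fixes \<mu> \<nu> :: "'a::euclidean_space measure"
  assumes \<nu>: "frostman \<nu> \<alpha>" and \<mu>: "finite_measure \<mu>" "sets \<mu> = sets borel" and "0 < \<alpha>"
  shows "AE x in \<nu>. upper_mass_bound \<mu> \<alpha> x"
proof -
  have "AE x in \<nu>. \<forall>n. \<forall>\<^sub>F r in at_right 0. measure \<mu> (cball x r) \<le> r powr (\<alpha> * (1 - 1 / real (n + 2)))"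
    using \<open>0 < \<alpha>\<close> by (intro AE_all_countable[THEN iffD2] allI frostman_large_balls[OF \<nu> \<mu>]) (auto simp: field_simps add_pos_nonneg)
  then show ?thesis
  proof eventually_elim
    case (elim x)
    show ?case unfolding upper_mass_bound_def
    proof (intro allI impI)
      fix \<epsilon> :: real assume "\<epsilon> > 0"
      then obtain n where "1 / real (Suc n) < \<epsilon> / \<alpha>" using \<open>0 < \<alpha>\<close> nat_approx_posE
        by (metis divide_pos_pos of_nat_Suc)
      moreover have "1 / real (n + 2) \<le> 1 / real (Suc n)" by (simp add: frac_le)
      ultimately have "1 / real (n + 2) < \<epsilon> / \<alpha>" by linarith
      then have "\<alpha> * (1 / real (n + 2)) < \<epsilon>" using \<open>0 < \<alpha>\<close> by (simp only: pos_less_divide_eq mult.commute)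
      then have n: "\<alpha> - \<epsilon> \<le> \<alpha> * (1 - 1 / real (n + 2))" by (simp only: right_diff_distrib)
      have "\<forall>\<^sub>F r in at_right 0. measure \<mu> (cball x r) \<le> r powr (\<alpha> * (1 - 1 / real (n + 2)))"
        using elim by blast
      then show "\<forall>\<^sub>F r in at_right 0. measure \<mu> (cball x r) \<le> r powr (\<alpha> - \<epsilon>)"
        using at_right_0_less_1
      proof eventually_elim
        case (elim r)
        then have "r powr (\<alpha> * (1 - 1 / real (n + 2))) \<le> r powr (\<alpha> - \<epsilon>)"
          using n by (intro powr_mono') auto
        with elim show ?case by linarith
      qed
    qed
  qed
qed

subsection \<open>Iterated function systems\<close>

text \<open>New letters act innermost, so a longer word refines the piece of its prefix: the images
  of an invariant set decrease with the word length.\<close>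

primrec code_map :: "(nat \<Rightarrow> 'a \<Rightarrow> 'a) \<Rightarrow> (nat \<Rightarrow> nat) \<Rightarrow> nat \<Rightarrow> 'a \<Rightarrow> 'a" where
  "code_map f \<omega> 0 = id"
| "code_map f \<omega> (Suc n) = code_map f \<omega> n \<circ> f (\<omega> n)"

lemma code_map_cong: "(\<And>k. k < n \<Longrightarrow> \<omega> k = \<omega>' k) \<Longrightarrow> code_map f \<omega> n = code_map f \<omega>' n"
  by (induction n) auto

lemma code_map_add: "code_map f \<omega> (n + k) = code_map f \<omega> n \<circ> code_map f (\<lambda>i. \<omega> (n + i)) k"
  by (induction k) (auto simp: o_assoc)

text \<open>Normalised by its ratio and its value at 0, the map is an isometry fixing the origin,
  hence an orthogonal transformation.\<close>

lemma similarity_surj: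
  fixes f :: "'a::euclidean_space \<Rightarrow> 'a"
  assumes "c > 0" and f: "\<And>x y. dist (f x) (f y) = c * dist x y"
  shows "surj f"
proof -
  define g where "g x = (f x - f 0) /\<^sub>R c" for x
  have "dist (g x) (g y) = dist x y" for x y
  proof -
    have "g x - g y = (f x - f y) /\<^sub>R c" by (simp add: g_def scaleR_diff_right)
    then have "dist (g x) (g y) = dist (f x) (f y) / c"
      using \<open>c > 0\<close> by (simp add: dist_norm divide_inverse_commute)
    then show ?thesis using f \<open>c > 0\<close> by simp
  qed
  then have "orthogonal_transformation g"
    by (auto simp: orthogonal_transformation_isometry g_def)
  then have "surj g" by (rule orthogonal_transformation_surj)
  show ?thesis unfolding surj_def
  proof
    fix y
    obtain x where "g x = (y - f 0) /\<^sub>R c" using \<open>surj g\<close> by (metis surjD)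
    then have "y = f x" using \<open>c > 0\<close> by (simp add: g_def)
    then show "\<exists>x. y = f x" ..
  qed
qed

text \<open>Rescaling by \<open>r\<close> reduces to one compact ball, covered by finitely many
  balls of radius \<open>a / 2\<close>; each holds at most one point of an
  \<open>a\<close>-separated set. Hence \<open>M\<close> depends on neither \<open>x\<close> nor
  \<open>r\<close>.\<close>

lemma separated_card_bound:
  fixes a b :: real
  assumes "a > 0"
  obtains M :: nat where "\<And>r (x::'a::euclidean_space) T. 0 < r \<Longrightarrow> T \<subseteq> cball x (b * r) \<Longrightarrow>
      (\<And>y z. y \<in> T \<Longrightarrow> z \<in> T \<Longrightarrow> y \<noteq> z \<Longrightarrow> a * r \<le> dist y z) \<Longrightarrow> finite T \<and> card T \<le> M"
proof -
  have "cball (0::'a) b \<subseteq> (\<Union>z\<in>cball 0 b. ball z (a / 2))"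
  proof
    fix z :: 'a assume "z \<in> cball 0 b"
    moreover have "z \<in> ball z (a / 2)" using \<open>a > 0\<close> by simp
    ultimately show "z \<in> (\<Union>z\<in>cball 0 b. ball z (a / 2))" by blast
  qed
  then obtain Z where Z: "finite Z" "cball (0::'a) b \<subseteq> (\<Union>z\<in>Z. ball z (a / 2))"
    by (rule compactE_image[OF compact_cball, rotated]) auto
  show thesis
  proof (rule that[of "card Z"])
    fix r and x :: 'a and T
    assume r: "0 < r" and T: "T \<subseteq> cball x (b * r)"
      and sep: "\<And>y z. y \<in> T \<Longrightarrow> z \<in> T \<Longrightarrow> y \<noteq> z \<Longrightarrow> a * r \<le> dist y z"
    define g where "g y = (y - x) /\<^sub>R r" for y
    have dg: "dist (g y) (g z) = dist y z / r" for y z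
    proof -
      have "g y - g z = (y - z) /\<^sub>R r" by (simp add: g_def scaleR_diff_right)
      then show ?thesis using r by (simp add: dist_norm divide_inverse_commute)
    qed
    have "\<exists>z\<in>Z. g y \<in> ball z (a / 2)" if "y \<in> T" for y
    proof -
      have "norm (y - x) \<le> b * r" using T that by (force simp: dist_norm norm_minus_commute)
      then have "norm (g y) \<le> b" using r by (simp add: g_def divide_simps mult.commute)
      then have "g y \<in> cball 0 b" by simp
      then show ?thesis using Z by blast
    qed
    then obtain h where h: "\<And>y. y \<in> T \<Longrightarrow> h y \<in> Z \<and> g y \<in> ball (h y) (a / 2)" by metis
    have inj: "inj_on h T"
    proof (rule inj_onI, rule ccontr)
      fix y z assume yz: "y \<in> T" "z \<in> T" "h y = h z" "y \<noteq> z"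
      have "dist (g y) (g z) < a"
        using h[OF yz(1)] h[OF yz(2)] yz(3) dist_triangle_half_r[of "h y" "g y" a "g z"] by simp
      then have "dist y z < a * r" using r by (simp add: dg divide_simps)
      with sep yz show False by force
    qed
    have "h ` T \<subseteq> Z" using h by auto
    then show "finite T \<and> card T \<le> card Z"
      using inj Z(1) by (metis card_inj_on_le finite_imageD finite_subset)
  qed
qed

text \<open>Only the inclusion of each image in \<open>K\<close> is assumed, so that a family of
  words is again an instance on the same \<open>K\<close>; the equality is a hypothesis of the
  lemmas about the full attractor.\<close>

locale ifs =
  fixes f :: "nat \<Rightarrow> 'a::euclidean_space \<Rightarrow> 'a" and N :: nat and c :: "nat \<Rightarrow> real" and K :: "'a set"
  assumes c: "\<And>i. i < N \<Longrightarrow> 0 < c i \<and> c i < 1"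
    and dist_f: "\<And>i x y. i < N \<Longrightarrow> dist (f i x) (f i y) = c i * dist x y"
    and compact_K: "compact K" and K_nonempty: "K \<noteq> {}"
    and f_K: "\<And>i. i < N \<Longrightarrow> f i ` K \<subseteq> K"
begin

abbreviation cm :: "(nat \<Rightarrow> nat) \<Rightarrow> nat \<Rightarrow> 'a \<Rightarrow> 'a" where "cm \<equiv> code_map f"

definition ratio :: "(nat \<Rightarrow> nat) \<Rightarrow> nat \<Rightarrow> real" where "ratio \<omega> n = (\<Prod>k<n. c (\<omega> k))"

lemma ratio_pos: "(\<And>k. k < n \<Longrightarrow> \<omega> k < N) \<Longrightarrow> 0 < ratio \<omega> n"
  unfolding ratio_def using c by (intro prod_pos) auto

lemma dist_cm:
  "(\<And>k. k < n \<Longrightarrow> \<omega> k < N) \<Longrightarrow> dist (cm \<omega> n x) (cm \<omega> n y) = ratio \<omega> n * dist x y"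
  by (induction n arbitrary: x y) (auto simp: ratio_def dist_f)

lemma cm_in_K: "(\<And>k. k < n \<Longrightarrow> \<omega> k < N) \<Longrightarrow> x \<in> K \<Longrightarrow> cm \<omega> n x \<in> K"
proof (induction n arbitrary: x)
  case (Suc n)
  then have "f (\<omega> n) x \<in> K" using f_K by (meson image_subset_iff lessI)
  then show ?case using Suc by simp
qed simp

lemma surj_cm: "(\<And>k. k < n \<Longrightarrow> \<omega> k < N) \<Longrightarrow> surj (cm \<omega> n)"
  by (rule similarity_surj[of "ratio \<omega> n"]) (auto simp: dist_cm intro: ratio_pos)

lemma ratio_le_power:
  assumes "\<And>i. i < N \<Longrightarrow> c i \<le> q" "\<And>k. k < n \<Longrightarrow> \<omega> k < N"
  shows "ratio \<omega> n \<le> q ^ n"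
proof -
  have "ratio \<omega> n \<le> (\<Prod>k<n. q)"
    unfolding ratio_def using assms c by (intro prod_mono) (auto intro: less_imp_le)
  then show ?thesis by simp
qed

lemma ex_max_ratio: "\<exists>q. 0 < q \<and> q < 1 \<and> (\<forall>i<N. c i \<le> q)"
proof -
  \<comment> \<open>The element \<open>1/2\<close> keeps the maximum defined and positive when
    \<open>N = 0\<close>.\<close>
  have fin: "finite (insert (1/2) (c ` {..<N}))" by simp
  have "Max (insert (1/2) (c ` {..<N})) < 1" using c by (subst Max_less_iff) auto
  moreover have "1/2 \<le> Max (insert (1/2) (c ` {..<N}))" using fin by (rule Max_ge) simp
  moreover have "c i \<le> Max (insert (1/2) (c ` {..<N}))" if "i < N" for i
    using fin by (rule Max_ge) (use that in auto)
  ultimately show ?thesis by (intro exI[of _ "Max (insert (1/2) (c ` {..<N}))"]) auto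
qed

definition base :: 'a where "base = (SOME x. x \<in> K)"

lemma base_in_K: "base \<in> K" using K_nonempty by (simp add: base_def some_in_eq)

text \<open>Adding 1 keeps \<open>D\<close>, later a factor of radii, positive when \<open>K\<close>
  is a single point.\<close>

definition D :: real where "D = diameter K + 1"

lemma dist_le_D: "x \<in> K \<Longrightarrow> y \<in> K \<Longrightarrow> dist x y \<le> D"
  using diameter_bounded_bound[OF compact_imp_bounded[OF compact_K], of x y] by (simp add: D_def)

lemma D_pos: "D > 0"
  using diameter_ge_0[OF compact_imp_bounded[OF compact_K]] by (simp add: D_def)

definition code_point :: "(nat \<Rightarrow> nat) \<Rightarrow> 'a" where "code_point \<omega> = lim (\<lambda>n. cm \<omega> n base)"

lemma dist_cm_add_le:
  assumes "\<And>k. \<omega> k < N"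
  shows "dist (cm \<omega> n base) (cm \<omega> (n + k) base) \<le> ratio \<omega> n * D"
proof -
  have "cm (\<lambda>i. \<omega> (n + i)) k base \<in> K" using assms base_in_K by (intro cm_in_K) auto
  then show ?thesis
    using assms ratio_pos[of n \<omega>] dist_le_D[OF base_in_K] by (simp add: code_map_add dist_cm)
qed

lemma cm_tendsto_code_point:
  assumes "\<And>k. \<omega> k < N"
  shows "(\<lambda>n. cm \<omega> n base) \<longlonglongrightarrow> code_point \<omega>"
proof -
  obtain q where q: "0 < q" "q < 1" "\<And>i. i < N \<Longrightarrow> c i \<le> q" using ex_max_ratio by blast
  have "Cauchy (\<lambda>n. cm \<omega> n base)"
  proof (rule metric_CauchyI)
    fix e :: real assume "e > 0"
    have "(\<lambda>n. q ^ n * D) \<longlonglongrightarrow> 0 * D" using q by (intro tendsto_mult tendsto_const LIMSEQ_realpow_zero) auto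
    then have "\<forall>\<^sub>F n in sequentially. q ^ n * D < e / 2"
      using \<open>e > 0\<close> by (intro order_tendstoD(2)[where y = 0]) auto
    then obtain n0 where n0: "q ^ n0 * D < e / 2" by (auto simp: eventually_sequentially)
    have "dist (cm \<omega> n0 base) (cm \<omega> m base) < e / 2" if "m \<ge> n0" for m
    proof -
      have "dist (cm \<omega> n0 base) (cm \<omega> (n0 + (m - n0)) base) \<le> ratio \<omega> n0 * D"
        using assms by (rule dist_cm_add_le)
      also have "\<dots> \<le> q ^ n0 * D"
        using D_pos q assms by (intro mult_right_mono ratio_le_power) auto
      finally show ?thesis using n0 that by simp
    qed
    then show "\<exists>M. \<forall>m\<ge>M. \<forall>n\<ge>M. dist (cm \<omega> m base) (cm \<omega> n base) < e"
      by (intro exI[of _ n0]) (metis dist_triangle_half_r)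
  qed
  then show ?thesis unfolding code_point_def by (simp add: Cauchy_convergent_iff convergent_LIMSEQ_iff)
qed

lemma code_point_in_K: "(\<And>k. \<omega> k < N) \<Longrightarrow> code_point \<omega> \<in> K"
  using cm_tendsto_code_point compact_imp_closed[OF compact_K] cm_in_K base_in_K
  by (auto intro!: Lim_in_closed_set[of K "\<lambda>n. cm \<omega> n base" sequentially])

lemma dist_cm_code_point_le:
  assumes "\<And>k. \<omega> k < N"
  shows "dist (cm \<omega> n base) (code_point \<omega>) \<le> ratio \<omega> n * D"
proof -
  have "(\<lambda>k. cm \<omega> (n + k) base) \<longlonglongrightarrow> code_point \<omega>"
    using LIMSEQ_ignore_initial_segment[OF cm_tendsto_code_point[OF assms], where k = n] by (simp add: add.commute)
  then have "(\<lambda>k. dist (cm \<omega> n base) (cm \<omega> (n + k) base)) \<longlonglongrightarrow> dist (cm \<omega> n base) (code_point \<omega>)"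
    by (intro tendsto_intros)
  then show ?thesis by (rule LIMSEQ_le_const2) (use dist_cm_add_le[OF assms] in auto)
qed

text \<open>For each point of \<open>K\<close>, choose a piece containing it and a preimage in
  \<open>K\<close>; iterating the preimages yields the digits.\<close>

lemma ex_coding:
  assumes K: "K = (\<Union>i<N. f i ` K)" and "x \<in> K"
  shows "\<exists>\<omega>. (\<forall>k. \<omega> k < N) \<and> (\<forall>n. x \<in> cm \<omega> n ` K)"
proof -
  have "\<exists>i z. i < N \<and> z \<in> K \<and> f i z = y" if "y \<in> K" for y
    using that by (subst (asm) K) auto
  then obtain dg nx where dn: "\<And>y. y \<in> K \<Longrightarrow> dg y < N \<and> nx y \<in> K \<and> f (dg y) (nx y) = y" by metis
  define y where "y n = (nx ^^ n) x" for n
  have y: "y n \<in> K" for n by (induction n) (use \<open>x \<in> K\<close> dn in \<open>auto simp: y_def\<close>)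
  define \<omega> where "\<omega> n = dg (y n)" for n
  have "cm \<omega> n (y n) = x" for n
  proof (induction n)
    case (Suc n)
    have "f (\<omega> n) (y (Suc n)) = y n" using dn[OF y[of n]] by (simp add: \<omega>_def y_def)
    then show ?case using Suc by simp
  qed (simp add: y_def)
  then have "x \<in> cm \<omega> n ` K" for n using y by (metis imageI)
  moreover have "\<omega> k < N" for k using dn[OF y] by (simp add: \<omega>_def)
  ultimately show ?thesis by blast
qed

end

section \<open>The open set condition\<close>

locale osc_ifs = ifs +
  fixes V :: "'a set"
  assumes open_V: "open V" and V_nonempty: "V \<noteq> {}"
    and f_V: "\<And>i. i < N \<Longrightarrow> f i ` V \<subseteq> V"
    and f_V_disjoint: "\<And>i j. i < N \<Longrightarrow> j < N \<Longrightarrow> i \<noteq> j \<Longrightarrow> f i ` V \<inter> f j ` V = {}"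
begin

lemma cm_V: "(\<And>k. k < n \<Longrightarrow> \<omega> k < N) \<Longrightarrow> cm \<omega> n ` V \<subseteq> V"
proof (induction n)
  case (Suc n)
  then have "f (\<omega> n) ` V \<subseteq> V" using f_V by simp
  then show ?case using Suc by (auto simp: image_comp[symmetric])
qed simp

text \<open>If an earlier letter differs, passing to the smaller pieces keeps them disjoint;
  otherwise one injective map is applied to two disjoint first-level pieces.\<close>

lemma cm_V_disjoint:
  assumes "\<And>k. k < n \<Longrightarrow> \<omega> k < N" "\<And>k. k < n \<Longrightarrow> \<omega>' k < N" "\<exists>k<n. \<omega> k \<noteq> \<omega>' k"
  shows "cm \<omega> n ` V \<inter> cm \<omega>' n ` V = {}"
  using assms
proof (induction n)
  case (Suc n)
  have sub: "cm \<omega> (Suc n) ` V = cm \<omega> n ` f (\<omega> n) ` V" "cm \<omega>' (Suc n) ` V = cm \<omega>' n ` f (\<omega>' n) ` V"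
    by (auto simp: image_comp)
  have fV: "f (\<omega> n) ` V \<subseteq> V" "f (\<omega>' n) ` V \<subseteq> V" using f_V Suc.prems by simp_all
  show ?case
  proof (cases "\<exists>k<n. \<omega> k \<noteq> \<omega>' k")
    case True
    then have "cm \<omega> n ` V \<inter> cm \<omega>' n ` V = {}" using Suc by simp
    then show ?thesis unfolding sub using fV by blast
  next
    case False
    then have eq: "cm \<omega> n = cm \<omega>' n" by (intro code_map_cong) auto
    have ne: "\<omega> n \<noteq> \<omega>' n" using False Suc.prems(3) by (metis less_Suc_eq)
    have pos: "ratio \<omega> n > 0" using Suc.prems by (intro ratio_pos) auto
    have "inj (cm \<omega> n)"
    proof (rule injI)
      fix x y assume "cm \<omega> n x = cm \<omega> n y"
      then have "ratio \<omega> n * dist x y = 0" using Suc.prems dist_cm[of n \<omega> x y] by simp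
      then show "x = y" using pos by simp
    qed
    then have "cm \<omega> (Suc n) ` V \<inter> cm \<omega>' (Suc n) ` V = cm \<omega> n ` (f (\<omega> n) ` V \<inter> f (\<omega>' n) ` V)"
      unfolding sub eq[symmetric] by (rule image_Int[symmetric])
    then show ?thesis using f_V_disjoint[OF _ _ ne] Suc.prems by simp
  qed
qed simp

text \<open>Here surjectivity of the similarities is used: \<open>cm \<omega> n\<close> maps the ball of radius \<open>a\<close> onto the
  ball of radius \<open>ratio \<omega> n * a\<close>.\<close>

lemma cm_separated:
  assumes "\<And>k. k < n \<Longrightarrow> \<omega> k < N" "\<And>k. k < n \<Longrightarrow> \<omega>' k < N" "\<exists>k<n. \<omega> k \<noteq> \<omega>' k"
    and "ball v a \<subseteq> V" "v \<in> V"
  shows "a * ratio \<omega> n \<le> dist (cm \<omega> n v) (cm \<omega>' n v)"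
proof (rule ccontr)
  assume *: "\<not> ?thesis"
  obtain z where z: "cm \<omega>' n v = cm \<omega> n z" using surj_cm[of n \<omega>] assms(1) by (metis surjD)
  have "ratio \<omega> n * dist v z < a * ratio \<omega> n" using * z dist_cm[of n \<omega> v z] assms(1) by simp
  then have "dist v z < a" using ratio_pos[of n \<omega>] assms(1) by (simp add: mult.commute)
  then have "z \<in> V" using assms(4) by auto
  then have "cm \<omega>' n v \<in> cm \<omega> n ` V \<inter> cm \<omega>' n ` V"
    using z \<open>v \<in> V\<close> by (metis IntI imageI)
  then show False using cm_V_disjoint[OF assms(1-3)] by simp
qed

end

subsection \<open>Random codings\<close>

abbreviation seq_measure :: "(nat \<Rightarrow> nat pmf) \<Rightarrow> (nat \<Rightarrow> nat) measure" where
  "seq_measure p \<equiv> Pi\<^sub>M UNIV (\<lambda>k. measure_pmf (p k))"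

lemma prob_space_seq_measure: "prob_space (seq_measure p)"
  by (intro prob_space_PiM measure_pmf.prob_space_axioms)

lemma AE_seq_measure:
  assumes "\<And>k. set_pmf (p k) \<subseteq> A k"
  shows "AE \<omega> in seq_measure p. \<forall>k. \<omega> k \<in> A k"
proof (intro AE_all_countable[THEN iffD2] allI)
  fix k
  show "AE \<omega> in seq_measure p. \<omega> k \<in> A k"
    using assms by (intro AE_PiM_component measure_pmf.prob_space_axioms) (auto intro!: AE_pmfI)
qed

lemma cylinder:
  "{\<omega>. \<forall>k<n. \<omega> k = w k} \<in> sets (seq_measure p)"
  "measure (seq_measure p) {\<omega>. \<forall>k<n. \<omega> k = w k} = (\<Prod>k<n. pmf (p k) (w k))"
proof -
  interpret product_prob_space "\<lambda>k. measure_pmf (p k)" UNIV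
    by (intro product_prob_spaceI measure_pmf.prob_space_axioms)
  have eq: "{\<omega>. \<forall>k<n. \<omega> k = w k} = prod_emb UNIV (\<lambda>k. measure_pmf (p k)) {..<n} (\<Pi>\<^sub>E k\<in>{..<n}. {w k})"
    by (subst prod_emb_PiE) (auto simp: PiE_UNIV_domain Pi_iff split: if_splits)
  show "{\<omega>. \<forall>k<n. \<omega> k = w k} \<in> sets (seq_measure p)"
    unfolding eq by (intro sets_PiM_I) auto
  show "measure (seq_measure p) {\<omega>. \<forall>k<n. \<omega> k = w k} = (\<Prod>k<n. pmf (p k) (w k))"
    unfolding eq by (subst measure_PiM_emb) (auto simp: measure_pmf_single)
qed

context ifs
begin

text \<open>A digit takes countably many values, so applying the map it selects is measurable;
  digits range over all naturals, hence the assumption on every \<open>f i\<close>. The start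
  \<open>g\<close> varies in the induction because the innermost map is peeled off first.\<close>

lemma measurable_code_point:
  assumes "\<And>i. f i \<in> borel_measurable borel"
  shows "code_point \<in> borel_measurable (seq_measure p)"
proof -
  have "(\<lambda>\<omega>. cm \<omega> n (g \<omega>)) \<in> borel_measurable (seq_measure p)"
    if "g \<in> borel_measurable (seq_measure p)" for n and g :: "(nat \<Rightarrow> nat) \<Rightarrow> 'a"
    using that
  proof (induction n arbitrary: g)
    case (Suc n)
    have "(\<lambda>\<omega>. \<omega> n) \<in> measurable (seq_measure p) (measure_pmf (p n))"
      by (rule measurable_component_singleton) simp
    then have "(\<lambda>\<omega>. \<omega> n) \<in> measurable (seq_measure p) (count_space UNIV)" by simp
    then have "(\<lambda>\<omega>. f (\<omega> n) (g \<omega>)) \<in> borel_measurable (seq_measure p)"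
      by (rule measurable_compose_countable[rotated]) (rule measurable_compose[OF Suc.prems assms])
    then show ?case using Suc.IH by simp
  qed simp
  then show ?thesis unfolding code_point_def[abs_def] by (intro borel_measurable_lim_metric) simp
qed

end

text \<open>Words of length \<open>n\<close> whose pieces reach the ball give separated points
  \<open>cm w n v\<close> within distance of order \<open>\<rho> ^ n\<close>. So at most
  \<open>M\<close> words occur, each of probability at most the product of the \<open>u k\<close>,
  and \<open>M\<close> depends only on the system.\<close>

lemma (in osc_ifs) code_measure_ball_bound:
  assumes \<rho>: "0 < \<rho>" "\<rho> < 1" "\<And>i. i < N \<Longrightarrow> c i = \<rho>"
    and meas: "\<And>i. f i \<in> borel_measurable borel"
  obtains M :: real where "0 \<le> M"
    "\<And>p n x r u. (\<And>k. set_pmf (p k) \<subseteq> {..<N}) \<Longrightarrow> (\<And>k i. pmf (p k) i \<le> u k) \<Longrightarrow>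
       0 < r \<Longrightarrow> r \<le> \<rho> ^ n \<Longrightarrow>
       measure (distr (seq_measure p) borel code_point) (cball x r) \<le> M * (\<Prod>k<n. u k)"
proof -
  obtain v where v: "v \<in> V" using V_nonempty by auto
  obtain a where a: "a > 0" "ball v a \<subseteq> V" using open_V v by (auto simp: open_contains_ball)
  \<comment> \<open>In units of \<open>\<rho> ^ n\<close>, the summands bound the distances from
    \<open>x\<close> to the code point, from there to the image of \<open>base\<close>, and on to
    the image of \<open>v\<close>.\<close>
  define b where "b = 1 + D + dist base v"
  obtain M where M: "\<And>r (x::'a) T. 0 < r \<Longrightarrow> T \<subseteq> cball x (b * r) \<Longrightarrow>
      (\<And>y z. y \<in> T \<Longrightarrow> z \<in> T \<Longrightarrow> y \<noteq> z \<Longrightarrow> a * r \<le> dist y z) \<Longrightarrow> finite T \<and> card T \<le> M"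
    using separated_card_bound[OF \<open>a > 0\<close>, of b] by metis
  have ratio: "ratio \<omega> n = \<rho> ^ n" if "\<And>k. k < n \<Longrightarrow> \<omega> k < N" for \<omega> n
    using that \<rho>(3) by (simp add: ratio_def)
  show thesis
  proof (rule that[of "real M"])
    fix p :: "nat \<Rightarrow> nat pmf" and n x r and u :: "nat \<Rightarrow> real"
    assume p: "\<And>k. set_pmf (p k) \<subseteq> {..<N}" and u: "\<And>k i. pmf (p k) i \<le> u k"
      and r: "0 < r" "r \<le> \<rho> ^ n"
    interpret P: prob_space "seq_measure p" by (rule prob_space_seq_measure)
    have pos: "\<rho> ^ n > 0" using \<rho> by simp
    define W where "W = {w \<in> {..<n} \<rightarrow>\<^sub>E {..<N}. \<exists>\<omega>. (\<forall>k. \<omega> k < N) \<and> (\<forall>k<n. \<omega> k = w k) \<and> code_point \<omega> \<in> cball x r}"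
    have WN: "w k < N" if "w \<in> W" "k < n" for w k using that by (auto simp: W_def)
    have "(\<lambda>w. cm w n v) ` W \<subseteq> cball x (b * \<rho> ^ n)"
    proof clarify
      fix w assume "w \<in> W"
      then obtain \<omega> where \<omega>: "\<And>k. \<omega> k < N" "\<And>k. k < n \<Longrightarrow> \<omega> k = w k" "code_point \<omega> \<in> cball x r"
        by (auto simp: W_def)
      have cmw: "cm w n = cm \<omega> n" using \<omega>(2) by (intro code_map_cong) simp
      have "dist x (cm \<omega> n v) \<le> dist x (code_point \<omega>) + dist (cm \<omega> n base) (code_point \<omega>) + dist (cm \<omega> n base) (cm \<omega> n v)"
        using dist_triangle[of x "cm \<omega> n v" "code_point \<omega>"] dist_triangle[of "code_point \<omega>" "cm \<omega> n v" "cm \<omega> n base"]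
        by (simp add: dist_commute)
      also have "\<dots> \<le> \<rho> ^ n + \<rho> ^ n * D + \<rho> ^ n * dist base v"
      proof (intro add_mono)
        have r': "ratio \<omega> n = \<rho> ^ n" using \<omega>(1) by (intro ratio)
        show "dist x (code_point \<omega>) \<le> \<rho> ^ n" using \<omega>(3) r by simp
        show "dist (cm \<omega> n base) (code_point \<omega>) \<le> \<rho> ^ n * D"
          using dist_cm_code_point_le[of \<omega> n] \<omega>(1) unfolding r' by blast
        show "dist (cm \<omega> n base) (cm \<omega> n v) \<le> \<rho> ^ n * dist base v"
          using dist_cm[of n \<omega> base v] \<omega>(1) unfolding r' by simp
      qed
      finally show "cm w n v \<in> cball x (b * \<rho> ^ n)" by (simp add: cmw b_def algebra_simps)
    qed
    moreover have sep: "a * \<rho> ^ n \<le> dist (cm w n v) (cm w' n v)" if "w \<in> W" "w' \<in> W" "w \<noteq> w'" for w w'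
    proof -
      have "\<exists>k<n. w k \<noteq> w' k"
        using that PiE_ext[of w "{..<n}" "\<lambda>_. {..<N}" w'] by (auto simp: W_def)
      then show ?thesis
        using cm_separated[of n w w' v a] WN that a v ratio[where \<omega> = w and n = n] by simp
    qed
    ultimately have "finite ((\<lambda>w. cm w n v) ` W) \<and> card ((\<lambda>w. cm w n v) ` W) \<le> M"
      using pos by (intro M) auto
    moreover have "inj_on (\<lambda>w. cm w n v) W"
    proof (rule inj_onI, rule ccontr)
      fix w w' assume "w \<in> W" "w' \<in> W" "cm w n v = cm w' n v" "w \<noteq> w'"
      with sep[of w w'] have "a * \<rho> ^ n \<le> 0" by simp
      then show False using mult_pos_pos[OF a(1) pos] by linarith
    qed
    ultimately have W: "finite W" "card W \<le> M" by (auto simp: card_image finite_image_iff)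
    have "measure (distr (seq_measure p) borel code_point) (cball x r) =
        P.prob (code_point -` cball x r \<inter> space (seq_measure p))"
      using measurable_code_point[OF meas] by (intro measure_distr) auto
    also have "\<dots> \<le> P.prob (\<Union>w\<in>W. {\<omega>. \<forall>k<n. \<omega> k = w k})"
    proof (rule P.finite_measure_mono_AE)
      show "AE \<omega> in seq_measure p. \<omega> \<in> code_point -` cball x r \<inter> space (seq_measure p) \<longrightarrow>
          \<omega> \<in> (\<Union>w\<in>W. {\<omega>. \<forall>k<n. \<omega> k = w k})"
        using AE_seq_measure[of p "\<lambda>_. {..<N}", OF p]
      proof eventually_elim
        case (elim \<omega>)
        show ?case
        proof
          assume "\<omega> \<in> code_point -` cball x r \<inter> space (seq_measure p)"
          then have "restrict \<omega> {..<n} \<in> W" using elim by (auto simp: W_def)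
          then show "\<omega> \<in> (\<Union>w\<in>W. {\<omega>. \<forall>k<n. \<omega> k = w k})"
            by (rule UN_I) simp
        qed
      qed
      show "(\<Union>w\<in>W. {\<omega>. \<forall>k<n. \<omega> k = w k}) \<in> sets (seq_measure p)"
        using W(1) cylinder(1) by (intro sets.finite_UN) auto
    qed
    also have "\<dots> \<le> (\<Sum>w\<in>W. P.prob {\<omega>. \<forall>k<n. \<omega> k = w k})"
      using W(1) cylinder(1) by (intro P.finite_measure_subadditive_finite) auto
    also have "\<dots> \<le> (\<Sum>w\<in>W. \<Prod>k<n. u k)"
      using u by (intro sum_mono) (auto simp: cylinder(2) intro!: prod_mono)
    also have "\<dots> \<le> real M * (\<Prod>k<n. u k)"
      using W(2) u by (auto intro!: mult_right_mono prod_nonneg intro: order_trans[OF pmf_nonneg])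
    finally show "measure (distr (seq_measure p) borel code_point) (cball x r) \<le> real M * (\<Prod>k<n. u k)" .
  qed simp
qed

subsection \<open>A low-discrepancy sequence\<close>

text \<open>The block \<open>{J\<^sup>2..<(J + 1)\<^sup>2}\<close> is mapped to the equally spaced points \<open>i / (2 * J + 1)\<close>.\<close>

definition phase :: "nat \<Rightarrow> real" where
  "phase k = (real k - real ((floor_sqrt k)\<^sup>2)) / (2 * real (floor_sqrt k) + 1)"

definition phase_count :: "real \<Rightarrow> nat \<Rightarrow> nat" where
  "phase_count \<theta> n = card {k. k < n \<and> phase k < \<theta>}"

lemma phase_0: "phase 0 = 0" by (simp add: phase_def)

lemma phase_count_mono: "m \<le> n \<Longrightarrow> phase_count \<theta> m \<le> phase_count \<theta> n"
  unfolding phase_count_def by (intro card_mono) auto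

lemma phase_square_add:
  assumes "i < 2 * J + 1"
  shows "phase (J\<^sup>2 + i) = real i / (2 * real J + 1)"
proof -
  have "floor_sqrt (J\<^sup>2 + i) = J"
    using assms by (intro floor_sqrt_unique) (auto simp: power2_eq_square)
  then show ?thesis by (simp add: phase_def)
qed

text \<open>With \<open>y = \<theta> * (2 * J + 1)\<close>, block \<open>J\<close> contributes the
  ceiling of \<open>y\<close>. So the excess over the expected count stays nonnegative and grows by
  at most 1 per block.\<close>

lemma phase_count_square:
  assumes "0 < \<theta>" "\<theta> \<le> 1"
  shows "\<theta> * real (J\<^sup>2) \<le> real (phase_count \<theta> (J\<^sup>2)) \<and> real (phase_count \<theta> (J\<^sup>2)) \<le> \<theta> * real (J\<^sup>2) + real J"
proof (induction J)
  case 0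
  then show ?case by (simp add: phase_count_def)
next
  case (Suc J)
  have sq: "(Suc J)\<^sup>2 = J\<^sup>2 + (2 * J + 1)" by (simp add: power2_eq_square)
  define y where "y = \<theta> * (2 * real J + 1)"
  have y: "0 < y" "y \<le> 2 * real J + 1" using assms by (auto simp: y_def mult_le_cancel_right1)
  have "{k. k < (Suc J)\<^sup>2 \<and> phase k < \<theta>} = {k. k < J\<^sup>2 \<and> phase k < \<theta>} \<union> (\<lambda>i. J\<^sup>2 + i) ` {..<nat \<lceil>y\<rceil>}"
    (is "?A = ?B \<union> ?C")
  proof (rule set_eqI)
    fix k
    show "k \<in> ?A \<longleftrightarrow> k \<in> ?B \<union> ?C"
    proof (cases "k < J\<^sup>2")
      case True
      then show ?thesis by (auto simp: sq)
    next
      case False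
      then obtain i where k: "k = J\<^sup>2 + i" by (metis le_Suc_ex not_less)
      have "k \<in> ?A \<longleftrightarrow> i < 2 * J + 1 \<and> real i < y"
        using phase_square_add[of i J] by (auto simp: k sq y_def divide_less_eq mult.commute)
      \<comment> \<open>Since \<open>\<theta> \<le> 1\<close>, the bound \<open>real i < y\<close>
        already places \<open>i\<close> inside the block.\<close>
      also have "\<dots> \<longleftrightarrow> real i < y"
        using y by (auto simp flip: of_nat_less_iff[where 'a = real])
      also have "\<dots> \<longleftrightarrow> i < nat \<lceil>y\<rceil>" by (simp add: zless_nat_eq_int_zless less_ceiling_iff)
      finally show ?thesis using k by auto
    qed
  qed
  moreover have "card (?B \<union> ?C) = card ?B + card ?C" by (intro card_Un_disjoint) auto
  moreover have "card ?C = nat \<lceil>y\<rceil>" by (simp add: card_image)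
  ultimately have "phase_count \<theta> ((Suc J)\<^sup>2) = phase_count \<theta> (J\<^sup>2) + nat \<lceil>y\<rceil>"
    by (simp add: phase_count_def)
  moreover have "y \<le> real (nat \<lceil>y\<rceil>)" "real (nat \<lceil>y\<rceil>) \<le> y + 1" using y by linarith+
  ultimately show ?case using Suc by (simp add: sq y_def algebra_simps)
qed

text \<open>Replacing \<open>n\<close> by a neighbouring square costs at most one block:
  \<open>2 * J + 1\<close> positions plus a discrepancy of at most \<open>J + 1\<close> above, and
  \<open>2 * J\<close> positions below.\<close>

lemma phase_count_bounds:
  assumes "0 < \<theta>" "\<theta> \<le> 1"
  shows "\<bar>real (phase_count \<theta> n) - \<theta> * real n\<bar> \<le> 3 * sqrt (real n) + 2"
proof -
  define J where "J = floor_sqrt n"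
  have J: "J\<^sup>2 \<le> n" "n < (Suc J)\<^sup>2" by (auto simp: J_def Suc_floor_sqrt_power2_gt)
  have Jn: "real J \<le> sqrt (real n)"
    using J(1) by (intro real_le_rsqrt) (metis of_nat_le_iff of_nat_power)
  have n2: "real n \<le> real (J\<^sup>2) + 2 * real J"
  proof -
    have "n \<le> J\<^sup>2 + 2 * J" using J(2) by (simp add: power2_eq_square)
    then have "real n \<le> real (J\<^sup>2 + 2 * J)" by (rule of_nat_mono)
    then show ?thesis by simp
  qed
  have le1: "\<theta> * z \<le> z" if "z \<ge> 0" for z using assms that by (simp add: mult_left_le_one_le)
  have "\<theta> * real n \<le> \<theta> * real (J\<^sup>2) + \<theta> * (2 * real J)"
    using n2 assms by (simp flip: distrib_left)
  also have "\<dots> \<le> real (phase_count \<theta> (J\<^sup>2)) + 2 * real J"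
    using phase_count_square[OF assms, of J] le1[of "2 * real J"] by simp
  also have "\<dots> \<le> real (phase_count \<theta> n) + 2 * real J"
    using phase_count_mono[OF J(1)] by simp
  finally have 1: "\<theta> * real n \<le> real (phase_count \<theta> n) + 2 * real J" .
  have "real (phase_count \<theta> n) \<le> real (phase_count \<theta> ((Suc J)\<^sup>2))"
    using phase_count_mono[of n "(Suc J)\<^sup>2"] J(2) by simp
  also have "\<dots> \<le> \<theta> * real ((Suc J)\<^sup>2) + real (Suc J)"
    using phase_count_square[OF assms, of "Suc J"] by simp
  also have "\<theta> * real ((Suc J)\<^sup>2) = \<theta> * real (J\<^sup>2) + \<theta> * (2 * real J + 1)"
    by (simp add: power2_eq_square algebra_simps)
  also have "\<dots> + real (Suc J) \<le> \<theta> * real n + (2 * real J + 1) + real (Suc J)"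
    using J(1) assms le1[of "2 * real J + 1"] by (intro add_mono mult_left_mono) auto
  finally show ?thesis using 1 Jn by linarith
qed

lemma phase_count_tendsto:
  assumes "0 < \<theta>" "\<theta> \<le> 1"
  shows "(\<lambda>n. real (phase_count \<theta> n) / real n) \<longlonglongrightarrow> \<theta>"
proof -
  have "\<forall>\<^sub>F n in sequentially. \<bar>real (phase_count \<theta> n) / real n - \<theta>\<bar> \<le> (3 * sqrt (real n) + 2) / real n"
    using eventually_gt_at_top[of 0]
  proof eventually_elim
    case (elim n)
    then have "real (phase_count \<theta> n) / real n - \<theta> = (real (phase_count \<theta> n) - \<theta> * real n) / real n"
      by (simp add: diff_divide_distrib)
    then have "\<bar>real (phase_count \<theta> n) / real n - \<theta>\<bar> = \<bar>real (phase_count \<theta> n) - \<theta> * real n\<bar> / real n"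
      by simp
    also have "\<dots> \<le> (3 * sqrt (real n) + 2) / real n"
      using phase_count_bounds[OF assms] by (intro divide_right_mono) auto
    finally show ?case .
  qed
  then have "\<forall>\<^sub>F n in sequentially. norm (real (phase_count \<theta> n) / real n - \<theta>) \<le> (3 * sqrt (real n) + 2) / real n"
    by (simp only: real_norm_def)
  moreover have "(\<lambda>n. (3 * sqrt (real n) + 2) / real n) \<longlonglongrightarrow> 0" by real_asymp
  ultimately have "(\<lambda>n. real (phase_count \<theta> n) / real n - \<theta>) \<longlonglongrightarrow> 0"
    by (rule Lim_null_comparison)
  then show ?thesis by (rule LIM_zero_cancel)
qed

subsection \<open>Mass at geometric scales\<close>

text \<open>Every small radius is comparable to some scale, and the constant factor lost is absorbed
  by half of the \<open>\<epsilon>\<close>.\<close>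

lemma lower_mass_boundI_scales:
  fixes \<mu> :: "'a::metric_space measure" and a :: "nat \<Rightarrow> real"
  assumes \<mu>: "finite_measure \<mu>" "sets \<mu> = sets borel"
    and a: "\<And>n. 0 < a n" "a \<longlonglongrightarrow> 0" "\<And>n. \<kappa> * a n \<le> a (Suc n)" and "\<kappa> > 0" "B > 0" "0 \<le> \<alpha>"
    and mass: "\<And>\<epsilon>. \<epsilon> > 0 \<Longrightarrow> \<forall>\<^sub>F n in sequentially. a n powr (\<alpha> + \<epsilon>) \<le> measure \<mu> (cball x (B * a n))"
  shows "lower_mass_bound \<mu> \<alpha> x"
  unfolding lower_mass_bound_def
proof (intro allI impI)
  interpret finite_measure \<mu> by fact
  fix \<epsilon> :: real assume "\<epsilon> > 0"
  define t where "t = \<alpha> + \<epsilon> / 2"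
  have "t > 0" using \<open>\<epsilon> > 0\<close> \<open>0 \<le> \<alpha>\<close> by (simp add: t_def)
  obtain n0 where n0: "\<And>n. n \<ge> n0 \<Longrightarrow> a n powr t \<le> measure \<mu> (cball x (B * a n))"
    using mass[of "\<epsilon> / 2"] \<open>\<epsilon> > 0\<close> by (auto simp: eventually_sequentially t_def)
  \<comment> \<open>Radii below \<open>d\<close> force the index of the chosen scale beyond
    \<open>n0\<close>.\<close>
  define d where "d = Min ((\<lambda>n. B * a n) ` {..n0})"
  have d: "d > 0" "\<And>n. n \<le> n0 \<Longrightarrow> d \<le> B * a n"
    using a(1) \<open>B > 0\<close> by (auto simp: d_def Min_gr_iff intro!: Min_le)
  define q where "q = (\<kappa> / B) powr t"
  have "q > 0" using \<open>\<kappa> > 0\<close> \<open>B > 0\<close> by (simp add: q_def)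
  have "((\<lambda>r::real. r powr (\<epsilon> / 2)) \<longlongrightarrow> 0 powr (\<epsilon> / 2)) (at_right 0)"
    using \<open>\<epsilon> > 0\<close> by (intro tendsto_powr') (auto intro!: eventually_at_rightI[of 0 1])
  then have "\<forall>\<^sub>F r in at_right 0. r powr (\<epsilon> / 2) < q"
    using \<open>q > 0\<close> by (intro order_tendstoD(2)[where y = 0]) auto
  moreover have "\<forall>\<^sub>F r in at_right 0. 0 < r \<and> r < d"
    using d(1) by (intro eventually_at_rightI[of 0 d]) auto
  ultimately show "\<forall>\<^sub>F r in at_right 0. r powr (\<alpha> + \<epsilon>) \<le> measure \<mu> (cball x r)"
  proof eventually_elim
    case (elim r)
    have "(\<lambda>n. B * a n) \<longlonglongrightarrow> B * 0" using a(2) by (intro tendsto_intros)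
    then have "\<forall>\<^sub>F n in sequentially. B * a n < r"
      using elim by (intro order_tendstoD(2)[where y = 0]) auto
    then have ex: "\<exists>n. B * a n \<le> r" by (meson eventually_happens' less_imp_le sequentially_bot)
    \<comment> \<open>The first scale that fits: its predecessor does not fit, so \<open>a n\<close>
      is at least \<open>\<kappa> / B * r\<close>.\<close>
    define n where "n = (LEAST n. B * a n \<le> r)"
    have n: "B * a n \<le> r" using ex unfolding n_def by (rule LeastI_ex)
    have "n > n0" using d(2)[of n] n elim by force
    then obtain m where m: "n = Suc m" by (cases n) auto
    have "\<not> B * a m \<le> r" using m not_less_Least[of m "\<lambda>n. B * a n \<le> r"] by (simp add: n_def)
    then have "r / B < a m" using \<open>B > 0\<close> by (simp add: field_simps)
    then have "\<kappa> * (r / B) \<le> \<kappa> * a m" using \<open>\<kappa> > 0\<close> by (intro mult_left_mono) auto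
    then have an: "\<kappa> / B * r \<le> a n" using a(3)[of m] m by simp
    have "r powr (\<alpha> + \<epsilon>) = r powr (\<epsilon> / 2) * r powr t" by (simp add: t_def add.commute flip: powr_add)
    also have "\<dots> \<le> q * r powr t" using elim by (intro mult_right_mono) auto
    also have "\<dots> = (\<kappa> / B * r) powr t"
      using \<open>\<kappa> > 0\<close> \<open>B > 0\<close> elim unfolding q_def by (intro powr_mult[symmetric])
    also have "\<dots> \<le> a n powr t"
      using an \<open>\<kappa> > 0\<close> \<open>B > 0\<close> elim \<open>t > 0\<close> by (intro powr_mono2) auto
    also have "\<dots> \<le> measure \<mu> (cball x (B * a n))" using n0 \<open>n > n0\<close> by simp
    also have "\<dots> \<le> measure \<mu> (cball x r)"
      using n \<mu> by (intro finite_measure_mono) auto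
    finally show ?case .
  qed
qed

subsection \<open>The diagonal measure of a homogeneous system\<close>

text \<open>Telescoping weights of polynomial decay: singling out one value costs a factor that any
  exponential gain absorbs.\<close>

definition heavy_pmf :: "nat pmf" where
  "heavy_pmf = embed_pmf (\<lambda>n. 1 / ((real n + 1) * (real n + 2)))"

lemma pmf_heavy: "pmf heavy_pmf n = 1 / ((real n + 1) * (real n + 2))"
  unfolding heavy_pmf_def
proof (rule pmf_embed_pmf)
  have "(\<lambda>n. 1 / (real n + 1) - 1 / (real (Suc n) + 1)) sums (1 / (real 0 + 1) - 0)"
    by (rule telescope_sums') real_asymp
  moreover have "1 / (real n + 1) - 1 / (real (Suc n) + 1) = 1 / ((real n + 1) * (real n + 2))" for n
    by (simp add: field_simps)
  ultimately have "(\<lambda>n. 1 / ((real n + 1) * (real n + 2))) sums 1" by simp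
  then have "(\<Sum>n. ennreal (1 / ((real n + 1) * (real n + 2)))) = ennreal 1"
    by (intro suminf_ennreal_eq) auto
  then show "(\<integral>\<^sup>+ n. ennreal (1 / ((real n + 1) * (real n + 2))) \<partial>count_space UNIV) = 1"
    by (simp only: nn_integral_count_space_nat ennreal_1)
qed simp

lemma pmf_heavy_antimono: "j \<le> n \<Longrightarrow> pmf heavy_pmf n \<le> pmf heavy_pmf j"
  by (auto simp: pmf_heavy intro!: divide_left_mono mult_mono)

lemma pmf_heavy_ge_power:
  assumes "0 < q" "q < 1"
  shows "\<forall>\<^sub>F n in sequentially. q ^ n \<le> pmf heavy_pmf n"
proof -
  have "(\<lambda>n. q ^ n * ((real n + 1) * (real n + 2))) \<longlonglongrightarrow> 0" using assms by real_asymp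
  then have "\<forall>\<^sub>F n in sequentially. q ^ n * ((real n + 1) * (real n + 2)) < 1"
    by (rule order_tendstoD(2)) simp
  then show ?thesis
  proof eventually_elim
    case (elim n)
    have "0 < (real n + 1) * (real n + 2)" by (intro mult_pos_pos) auto
    then show ?case using elim by (simp add: pmf_heavy pos_le_divide_eq)
  qed
qed

lemma measure_bind_pmf_ge:
  fixes M :: "'a pmf" and F :: "'a \<Rightarrow> 'b pmf"
  shows "pmf M i * measure (F i) A \<le> measure (bind_pmf M F) A"
proof -
  have "ennreal (pmf M i * measure (F i) A) = (\<integral>\<^sup>+x. emeasure (F i) A * indicator {i} x \<partial>M)"
    by (subst nn_integral_cmult_indicator)
      (simp_all add: measure_pmf_single measure_pmf.emeasure_eq_measure ennreal_mult mult.commute)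
  also have "\<dots> \<le> (\<integral>\<^sup>+x. emeasure (F x) A \<partial>M)"
    by (intro nn_integral_mono) (auto simp: indicator_def)
  also have "\<dots> = ennreal (measure (bind_pmf M F) A)"
    by (simp add: emeasure_bind_pmf flip: measure_pmf.emeasure_eq_measure)
  finally show ?thesis by simp
qed

text \<open>The threshold can be replaced by the largest phase below it among the first
  \<open>n\<close> positions; position 0 guarantees that there is one. Thus \<open>n\<close>
  candidate sets serve all \<theta>, and a countable mixture can handle every exponent.\<close>

lemma ex_phase_threshold:
  assumes "0 < n" "0 < \<theta>"
  obtains j where "j < n" "\<And>k. k < n \<Longrightarrow> phase k < \<theta> \<longleftrightarrow> phase k \<le> phase j"
proof -
  let ?A = "{k. k < n \<and> phase k < \<theta>}"
  have fin: "finite ?A" by simp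
  have "0 \<in> ?A" using assms by (simp add: phase_0)
  then have "Max (phase ` ?A) \<in> phase ` ?A" using fin by (intro Max_in) auto
  then obtain j where j: "j \<in> ?A" "phase j = Max (phase ` ?A)" by auto
  have "phase k < \<theta> \<longleftrightarrow> phase k \<le> phase j" if "k < n" for k
  proof
    assume "phase k < \<theta>"
    then show "phase k \<le> phase j" unfolding j(2) using fin that by (intro Max_ge) auto
  qed (use j(1) in auto)
  with j(1) show thesis by (intro that[of j]) auto
qed

text \<open>In \<open>measure_pmf\<close> every set is measurable; the transfer to the Borel sets
  meets the hypotheses \<open>sets \<mu> = sets borel\<close>.\<close>

abbreviation pmf_borel :: "'a::metric_space pmf \<Rightarrow> 'a measure" where
  "pmf_borel P \<equiv> distr (measure_pmf P) borel (\<lambda>x. x)"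

lemma measure_pmf_borel: "A \<in> sets borel \<Longrightarrow> measure (pmf_borel P) A = measure (measure_pmf P) A"
  by (subst measure_distr) auto

lemma finite_measure_pmf_borel: "finite_measure (pmf_borel P)"
  by (intro finite_measure.finite_measure_distr measure_pmf.finite_measure_axioms) simp

text \<open>The Frostman measure is presented as the law of a random point because the set of points
  satisfying the lower mass bound has not been shown to be measurable.\<close>

definition diagonal_mass :: "'a::metric_space set \<Rightarrow> 'a pmf \<Rightarrow> real \<Rightarrow> bool" where
  "diagonal_mass K P \<alpha> \<longleftrightarrow> (\<exists>(\<Omega> :: (nat \<Rightarrow> nat) measure) \<pi>. prob_space \<Omega> \<and> \<pi> \<in> borel_measurable \<Omega> \<and>
     frostman (distr \<Omega> borel \<pi>) \<alpha> \<and>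
     (AE \<omega> in \<Omega>. \<pi> \<omega> \<in> K \<and> lower_mass_bound (pmf_borel P) \<alpha> (\<pi> \<omega>)))"

definition digits :: "nat \<Rightarrow> (nat \<Rightarrow> bool) \<Rightarrow> nat \<Rightarrow> nat pmf" where
  "digits N A k = (if A k then pmf_of_set {..<N} else return_pmf 0)"

lemma set_digits: "0 < N \<Longrightarrow> set_pmf (digits N A k) = (if A k then {..<N} else {0})"
  by (auto simp: digits_def set_pmf_of_set lessThan_empty_iff)

lemma pmf_digits:
  assumes "0 < N"
  shows "pmf (digits N A k) i = (if A k then indicator {..<N} i / real N else indicator {0} i)"
proof -
  have "{..<N} \<noteq> {}" using assms by (auto simp: lessThan_empty_iff)
  then show ?thesis by (auto simp: digits_def indicator_def)
qed

lemma prod_if_const: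
  fixes a :: real and n :: nat
  shows "(\<Prod>k<n. if A k then a else 1) = a ^ card {k. k < n \<and> A k}"
proof -
  have "(\<Prod>k<n. if A k then a else 1) = (\<Prod>k\<in>{k \<in> {..<n}. A k}. a)"
    by (rule prod.inter_filter[symmetric]) simp
  then show ?thesis by simp
qed

lemma ex_power_scale:
  fixes \<rho> r :: real
  assumes "0 < \<rho>" "\<rho> < 1" "0 < r" "r \<le> 1"
  obtains n where "\<rho> ^ Suc n < r" "r \<le> \<rho> ^ n"
proof -
  obtain k where k: "\<rho> ^ k < r" using real_arch_pow_inv assms by blast
  moreover have "\<rho> ^ Suc k \<le> \<rho> ^ k" using assms by (intro power_decreasing) auto
  ultimately have ex: "\<exists>n. \<rho> ^ Suc n < r" by (metis le_less_trans)
  define n where "n = (LEAST n. \<rho> ^ Suc n < r)"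
  have "\<rho> ^ Suc n < r" using ex unfolding n_def by (rule LeastI_ex)
  moreover have "r \<le> \<rho> ^ n"
  proof (cases n)
    case (Suc m)
    then have "\<not> \<rho> ^ Suc m < r" using not_less_Least[of m "\<lambda>n. \<rho> ^ Suc n < r"] by (simp add: n_def)
    then show ?thesis using Suc by simp
  qed (use assms in simp)
  ultimately show thesis by (rule that)
qed

definition (in ifs) level_pmf :: "nat \<Rightarrow> (nat \<Rightarrow> nat pmf) \<Rightarrow> 'a pmf" where
  "level_pmf n p = map_pmf (\<lambda>w. cm w n base) (Pi_pmf {..<n} 0 p)"

lemma (in ifs) set_level_pmf:
  assumes "\<And>k. set_pmf (p k) \<subseteq> {..<N}"
  shows "set_pmf (level_pmf n p) \<subseteq> K"
proof -
  have "cm w n base \<in> K" if "w \<in> set_pmf (Pi_pmf {..<n} 0 p)" for w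
  proof (rule cm_in_K[OF _ base_in_K])
    fix k assume "k < n"
    then have "w k \<in> set_pmf (p k)"
      using that set_Pi_pmf_subset'[of "{..<n}" 0 p] by (auto simp: PiE_dflt_def)
    then show "w k < N" using assms by blast
  qed
  then show ?thesis by (auto simp: level_pmf_def)
qed

lemma (in ifs) measure_level_pmf_ge:
  assumes \<omega>: "\<And>k. \<omega> k < N" and x: "dist (cm \<omega> n base) x \<le> r"
  shows "(\<Prod>k<n. pmf (p k) (\<omega> k)) \<le> measure (level_pmf n p) (cball x r)"
proof -
  \<comment> \<open>Beyond position \<open>n\<close> the word must take the default value 0 of
    \<open>Pi_pmf\<close>, otherwise its probability is 0.\<close>
  define w where "w k = (if k < n then \<omega> k else 0)" for k
  have cm: "cm w n = cm \<omega> n" by (intro code_map_cong) (simp add: w_def)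
  have "(\<Prod>k<n. pmf (p k) (\<omega> k)) = pmf (Pi_pmf {..<n} 0 p) w"
    by (subst pmf_Pi') (auto simp: w_def)
  also have "\<dots> = measure (Pi_pmf {..<n} 0 p) {w}" by (simp add: measure_pmf_single)
  also have "\<dots> \<le> measure (Pi_pmf {..<n} 0 p) ((\<lambda>w. cm w n base) -` cball x r)"
    using x by (intro measure_pmf.finite_measure_mono) (auto simp: cm dist_commute)
  finally show ?thesis by (simp add: level_pmf_def)
qed

text \<open>For \<open>\<theta> = \<alpha> / \<sigma>\<close>, admissible words of length
  \<open>n\<close> have probability \<open>\<rho> powr (\<sigma> * phase_count \<theta> n)\<close>,
  roughly \<open>\<rho> powr (\<alpha> * n)\<close>. This yields the Frostman bound, and
  \<open>P\<close> reproduces it from below up to two weights of \<open>heavy_pmf\<close>.\<close>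

lemma (in osc_ifs) homogeneous_diagonal_pmf:
  assumes \<rho>: "0 < \<rho>" "\<rho> < 1" "\<And>i. i < N \<Longrightarrow> c i = \<rho>"
    and meas: "\<And>i. f i \<in> borel_measurable borel"
    and \<sigma>: "0 < \<sigma>" "real N * \<rho> powr \<sigma> = 1"
  shows "\<exists>P. set_pmf P \<subseteq> K \<and> (\<forall>\<alpha>. 0 < \<alpha> \<and> \<alpha> < \<sigma> \<longrightarrow> diagonal_mass K P \<alpha>)"
proof -
  have "N > 0" using \<sigma>(2) by (cases N) auto
  have invN: "1 / real N = \<rho> powr \<sigma>" using \<sigma>(2) \<open>N > 0\<close> by (simp add: field_simps)
  define P where "P = bind_pmf heavy_pmf (\<lambda>n. bind_pmf heavy_pmf
      (\<lambda>j. level_pmf n (digits N (\<lambda>k. phase k \<le> phase j))))"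
  have dN: "set_pmf (digits N A k) \<subseteq> {..<N}" for A k using \<open>N > 0\<close> by (simp add: set_digits)
  have "set_pmf (level_pmf n (digits N A)) \<subseteq> K" for n A by (rule set_level_pmf[OF dN])
  then have "set_pmf P \<subseteq> K" unfolding P_def set_bind_pmf by blast
  moreover have "diagonal_mass K P \<alpha>" if \<alpha>: "0 < \<alpha>" "\<alpha> < \<sigma>" for \<alpha>
  proof -
    define \<theta> where "\<theta> = \<alpha> / \<sigma>"
    have \<theta>: "0 < \<theta>" "\<theta> < 1" using \<alpha> \<sigma> by (auto simp: \<theta>_def)
    define p where "p = digits N (\<lambda>k. phase k < \<theta>)"
    define u where "u k = (if phase k < \<theta> then 1 / real N else 1)" for k
    have prod_u: "(\<Prod>k<n. u k) = \<rho> powr (\<sigma> * real (phase_count \<theta> n))" for n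
    proof -
      have "(\<Prod>k<n. u k) = (\<rho> powr \<sigma>) ^ phase_count \<theta> n"
        unfolding u_def prod_if_const phase_count_def invN ..
      then show ?thesis using \<rho> by (simp add: powr_powr flip: powr_realpow)
    qed
    have count: "(\<lambda>n. real (phase_count \<theta> n) / real n) \<longlonglongrightarrow> \<theta>"
      using \<theta> by (intro phase_count_tendsto) auto
    have p_le: "pmf (p k) i \<le> u k" for k i
      using \<open>N > 0\<close> by (auto simp: p_def u_def pmf_digits indicator_def)
    interpret Q: prob_space "seq_measure p" by (rule prob_space_seq_measure)
    have cpm: "code_point \<in> borel_measurable (seq_measure p)" by (rule measurable_code_point[OF meas])
    obtain M where M: "0 \<le> M" "\<And>n x r. 0 < r \<Longrightarrow> r \<le> \<rho> ^ n \<Longrightarrow>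
       measure (distr (seq_measure p) borel code_point) (cball x r) \<le> M * (\<Prod>k<n. u k)"
      using code_measure_ball_bound[OF \<rho> meas] dN p_le unfolding p_def by metis
    have "frostman (distr (seq_measure p) borel code_point) \<alpha>"
      unfolding frostman_def
    proof (intro conjI allI impI)
      show "prob_space (distr (seq_measure p) borel code_point)" using cpm by (rule Q.prob_space_distr)
      fix t assume t: "0 < t \<and> t < \<alpha>"
      then have "t / \<sigma> < \<theta>" using \<sigma> by (simp add: \<theta>_def divide_strict_right_mono)
      then have "\<forall>\<^sub>F n in sequentially. t / \<sigma> < real (phase_count \<theta> n) / real n"
        using count by (intro order_tendstoD(1))
      then obtain n0 where n0: "\<And>n. n \<ge> n0 \<Longrightarrow> t / \<sigma> < real (phase_count \<theta> n) / real n"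
        by (auto simp: eventually_sequentially)
      \<comment> \<open>The limit controls only \<open>n \<ge> n0\<close>; the loss
        \<open>t * n0\<close> extends the bound to all \<open>n\<close>.\<close>
      have le: "t * real n - t * real n0 \<le> \<sigma> * real (phase_count \<theta> n)" for n
      proof (cases "n \<ge> n0 \<and> n > 0")
        case True
        then have "t * real n < real (phase_count \<theta> n) * \<sigma>"
          using n0[of n] \<sigma>(1) by (simp add: divide_simps split: if_splits)
        moreover have "0 \<le> t * real n0" using t by simp
        ultimately show ?thesis by (simp add: mult.commute)
      next
        case False
        then have "real n \<le> real n0" by auto
        then have "t * real n \<le> t * real n0" using t by (intro mult_left_mono) auto
        moreover have "0 \<le> \<sigma> * real (phase_count \<theta> n)" using \<sigma> by simp
        ultimately show ?thesis by linarith
      qed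
      \<comment> \<open>The extra \<open>- t\<close> in the exponent pays for passing from
        \<open>\<rho> ^ n\<close> to \<open>\<rho> ^ Suc n\<close>, the power below
        \<open>r\<close>.\<close>
      define C where "C = M * \<rho> powr (- t * real n0 - t)"
      have "measure (distr (seq_measure p) borel code_point) (cball x r) \<le> C * r powr t"
        if r: "0 < r" "r \<le> 1" for x r
      proof -
        obtain n where n: "\<rho> ^ Suc n < r" "r \<le> \<rho> ^ n" using ex_power_scale[OF \<rho>(1,2) r] .
        have "measure (distr (seq_measure p) borel code_point) (cball x r) \<le> M * \<rho> powr (\<sigma> * real (phase_count \<theta> n))"
          using M(2)[OF r(1) n(2)] by (simp add: prod_u)
        also have "\<dots> \<le> M * \<rho> powr (t * real n - t * real n0)"
          using le M(1) \<rho> by (intro mult_left_mono powr_mono') auto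
        also have "\<rho> powr (t * real n - t * real n0) = \<rho> powr (- t * real n0 - t) * \<rho> powr (t * real (Suc n))"
          by (simp add: algebra_simps flip: powr_add)
        also have "\<rho> powr (t * real (Suc n)) = (\<rho> ^ Suc n) powr t"
          using \<rho> powr_realpow[of \<rho> "Suc n"] by (metis mult.commute powr_powr)
        also have "M * (\<rho> powr (- t * real n0 - t) * (\<rho> ^ Suc n) powr t) \<le> M * (\<rho> powr (- t * real n0 - t) * r powr t)"
          using n(1) M(1) t \<rho> by (intro mult_left_mono powr_mono2) auto
        finally show ?thesis by (simp add: C_def mult.assoc)
      qed
      then show "\<exists>C. \<forall>x r. 0 < r \<and> r \<le> 1 \<longrightarrow>
          measure (distr (seq_measure p) borel code_point) (cball x r) \<le> C * r powr t" by blast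
    qed simp
    moreover have "AE \<omega> in seq_measure p. code_point \<omega> \<in> K \<and> lower_mass_bound (pmf_borel P) \<alpha> (code_point \<omega>)"
      using AE_seq_measure[of p "\<lambda>k. set_pmf (p k)", OF order.refl]
    proof eventually_elim
      case (elim \<omega>)
      have \<omega>N: "\<omega> k < N" for k using elim dN by (auto simp: p_def)
      have \<omega>0: "\<omega> k = 0" if "\<not> phase k < \<theta>" for k
      proof -
        have "\<omega> k \<in> set_pmf (p k)" using elim by blast
        then show ?thesis using that \<open>N > 0\<close> by (simp add: p_def set_digits)
      qed
      \<comment> \<open>One weight selects the level \<open>n\<close>, the other the threshold
        position \<open>j < n\<close>, whose weight is at least that of \<open>n\<close>.\<close>
      have mass: "pmf heavy_pmf n * (pmf heavy_pmf n * \<rho> powr (\<sigma> * real (phase_count \<theta> n)))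
          \<le> measure (pmf_borel P) (cball (code_point \<omega>) (D * \<rho> ^ n))" if n: "n > 0" for n
      proof -
        obtain j where j: "j < n" "\<And>k. k < n \<Longrightarrow> phase k < \<theta> \<longleftrightarrow> phase k \<le> phase j"
          using ex_phase_threshold[OF n \<theta>(1)] by metis
        let ?B = "cball (code_point \<omega>) (D * \<rho> ^ n)"
        let ?d = "\<lambda>j. digits N (\<lambda>k. phase k \<le> phase j)"
        \<comment> \<open>At free positions each digit has probability \<open>1 / N\<close>; at the
          others \<open>\<omega> k = 0\<close> is certain.\<close>
        have "pmf (?d j k) (\<omega> k) = u k" if "k < n" for k
          using j(2)[OF that] \<omega>N \<omega>0 \<open>N > 0\<close> by (auto simp: pmf_digits u_def)
        then have "\<rho> powr (\<sigma> * real (phase_count \<theta> n)) = (\<Prod>k<n. pmf (?d j k) (\<omega> k))"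
          by (simp flip: prod_u)
        also have "\<dots> \<le> measure (level_pmf n (?d j)) ?B"
        proof (rule measure_level_pmf_ge[OF \<omega>N])
          show "dist (cm \<omega> n base) (code_point \<omega>) \<le> D * \<rho> ^ n"
            using dist_cm_code_point_le[of \<omega> n] \<omega>N \<rho>(3) by (simp add: ratio_def mult.commute)
        qed
        finally have "pmf heavy_pmf n * (pmf heavy_pmf n * \<rho> powr (\<sigma> * real (phase_count \<theta> n))) \<le>
            pmf heavy_pmf n * (pmf heavy_pmf j * measure (level_pmf n (?d j)) ?B)"
          using pmf_heavy_antimono[of j n] j(1) by (intro mult_left_mono mult_mono) auto
        also have "\<dots> \<le> pmf heavy_pmf n * measure (bind_pmf heavy_pmf (\<lambda>j. level_pmf n (?d j))) ?B"
          by (intro mult_left_mono measure_bind_pmf_ge) auto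
        also have "\<dots> \<le> measure P ?B"
          unfolding P_def by (rule measure_bind_pmf_ge)
        also have "\<dots> = measure (pmf_borel P) ?B" by (simp add: measure_pmf_borel)
        finally show ?thesis .
      qed
      have "lower_mass_bound (pmf_borel P) \<alpha> (code_point \<omega>)"
      proof (rule lower_mass_boundI_scales[where a = "\<lambda>n. \<rho> ^ n" and \<kappa> = \<rho> and B = D])
        show "(\<lambda>n. \<rho> ^ n) \<longlonglongrightarrow> 0" using \<rho> by (intro LIMSEQ_realpow_zero) auto
        fix \<epsilon> :: real assume "\<epsilon> > 0"
        \<comment> \<open>The slack is split into \<open>\<epsilon> / 4\<close> for each of the two
          weights and \<open>\<epsilon> / 2\<close> for the fluctuation of
          \<open>phase_count\<close>.\<close>
        define q where "q = \<rho> powr (\<epsilon> / 4)"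
        have q: "0 < q" "q < 1" using \<rho> \<open>\<epsilon> > 0\<close> powr_less_mono'[of \<rho> 0 "\<epsilon> / 4"] by (auto simp: q_def)
        have "\<theta> < (\<alpha> + \<epsilon> / 2) / \<sigma>" using \<open>\<epsilon> > 0\<close> \<sigma> by (simp add: \<theta>_def divide_strict_right_mono)
        then have "\<forall>\<^sub>F n in sequentially. real (phase_count \<theta> n) / real n < (\<alpha> + \<epsilon> / 2) / \<sigma>"
          using count by (intro order_tendstoD(2))
        then show "\<forall>\<^sub>F n in sequentially. (\<rho> ^ n) powr (\<alpha> + \<epsilon>)
            \<le> measure (pmf_borel P) (cball (code_point \<omega>) (D * \<rho> ^ n))"
          using pmf_heavy_ge_power[OF q] eventually_gt_at_top[of 0]
        proof eventually_elim
          case (elim n)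
          have s: "\<sigma> * real (phase_count \<theta> n) \<le> (\<alpha> + \<epsilon> / 2) * real n"
            using elim \<sigma>(1) by (simp add: divide_simps mult_ac split: if_splits)
          have qn: "q ^ n = \<rho> powr (\<epsilon> / 4 * real n)"
            using q by (simp add: q_def powr_powr flip: powr_realpow)
          have "(\<rho> ^ n) powr (\<alpha> + \<epsilon>) = \<rho> powr ((\<alpha> + \<epsilon>) * real n)"
            using \<rho> powr_realpow[of \<rho> n] by (metis mult.commute powr_powr)
          also have "\<dots> = q ^ n * (q ^ n * \<rho> powr ((\<alpha> + \<epsilon> / 2) * real n))"
            unfolding qn by (simp add: algebra_simps flip: powr_add)
          also have "\<dots> \<le> pmf heavy_pmf n * (pmf heavy_pmf n * \<rho> powr (\<sigma> * real (phase_count \<theta> n)))"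
          proof -
            have "\<rho> powr ((\<alpha> + \<epsilon> / 2) * real n) \<le> \<rho> powr (\<sigma> * real (phase_count \<theta> n))"
              using s \<rho> by (intro powr_mono') auto
            then show ?thesis using elim(2) q by (intro mult_mono) auto
          qed
          also note mass[OF elim(3)]
          finally show ?case .
        qed
      qed (use \<rho> D_pos \<alpha> finite_measure_pmf_borel in auto)
      then show ?case using code_point_in_K \<omega>N by blast
    qed
    ultimately show ?thesis
      unfolding diagonal_mass_def using cpm Q.prob_space_axioms by blast
  qed
  ultimately show ?thesis by blast
qed

subsection \<open>Homogeneous subsystems\<close>

context ifs
begin

text \<open>Intermediate value theorem: the sum is \<open>N\<close> at exponent 0 and at most 1 at a
  large \<open>k\<close>, where \<open>N * q ^ k < 1\<close>.\<close>

lemma ex_similarity_dim: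
  assumes "0 < N"
  obtains s where "0 \<le> s" "(\<Sum>i<N. c i powr s) = 1"
proof -
  obtain q where q: "0 < q" "q < 1" "\<And>i. i < N \<Longrightarrow> c i \<le> q" using ex_max_ratio by blast
  obtain k where k: "q ^ k < 1 / real N" using real_arch_pow_inv[of "1 / real N" q] q assms by auto
  have "(\<Sum>i<N. c i powr real k) \<le> (\<Sum>i<N. q ^ k)"
  proof (rule sum_mono)
    fix i assume "i \<in> {..<N}"
    then show "c i powr real k \<le> q ^ k"
      using c[of i] q(3)[of i] power_mono[of "c i" q k] by (simp add: powr_realpow)
  qed
  also have "\<dots> \<le> 1" using k assms by (simp add: field_simps)
  finally have 1: "(\<Sum>i<N. c i powr real k) \<le> 1" .
  have "c i powr 0 = 1" if "i < N" for i using c[OF that] by simp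
  then have 0: "1 \<le> (\<Sum>i<N. c i powr 0)" using assms by simp
  have "\<exists>s. 0 \<le> s \<and> s \<le> real k \<and> (\<Sum>i<N. c i powr s) = 1"
  proof (rule IVT2')
    have "c i \<noteq> 0" if "i < N" for i using c[OF that] by simp
    then show "continuous_on {0..real k} (\<lambda>s. \<Sum>i<N. c i powr s)"
      by (intro continuous_intros) auto
  qed (use 0 1 in auto)
  then show thesis using that by blast
qed

lemma sum_ratio_powr:
  assumes "(\<Sum>i<N. c i powr s) = 1"
  shows "(\<Sum>w\<in>{..<n} \<rightarrow>\<^sub>E {..<N}. ratio w n powr s) = 1"
proof -
  have "(\<Sum>w\<in>{..<n} \<rightarrow>\<^sub>E {..<N}. ratio w n powr s) = (\<Sum>w\<in>{..<n} \<rightarrow>\<^sub>E {..<N}. \<Prod>k<n. c (w k) powr s)"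
    unfolding ratio_def by (intro sum.cong refl prod_powr_distrib)
  also have "\<dots> = (\<Prod>k<n. \<Sum>i<N. c i powr s)"
    by (rule prod_sum_PiE[symmetric]) auto
  finally show ?thesis using assms by simp
qed

text \<open>The ratio of a word depends only on how often each letter occurs in it.\<close>

lemma card_ratios_le: "card ((\<lambda>w. ratio w n) ` ({..<n} \<rightarrow>\<^sub>E {..<N})) \<le> (n + 1) ^ N"
proof -
  define occ where "occ w = (\<lambda>i\<in>{..<N}. card {k\<in>{..<n}. w k = i})" for w :: "nat \<Rightarrow> nat"
  have "ratio w n = (\<Prod>i<N. c i ^ occ w i)" if "w \<in> {..<n} \<rightarrow>\<^sub>E {..<N}" for w
  proof -
    have "(\<Prod>i<N. \<Prod>k\<in>{k\<in>{..<n}. w k = i}. c (w k)) = (\<Prod>k<n. c (w k))"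
      using that by (intro prod.group) auto
    moreover have "(\<Prod>k\<in>{k\<in>{..<n}. w k = i}. c (w k)) = c i ^ occ w i" if "i < N" for i
      using that by (simp add: occ_def)
    ultimately show ?thesis by (simp add: ratio_def)
  qed
  then have "(\<lambda>w. ratio w n) ` ({..<n} \<rightarrow>\<^sub>E {..<N}) \<subseteq> (\<lambda>m. \<Prod>i<N. c i ^ m i) ` ({..<N} \<rightarrow>\<^sub>E {..n})"
  proof (intro image_subsetI)
    fix w assume "w \<in> {..<n} \<rightarrow>\<^sub>E {..<N}"
    moreover have "card {k\<in>{..<n}. w k = i} \<le> n" for i
      using card_mono[of "{..<n}" "{k\<in>{..<n}. w k = i}"] by auto
    then have "occ w \<in> {..<N} \<rightarrow>\<^sub>E {..n}" by (auto simp: occ_def)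
    ultimately show "ratio w n \<in> (\<lambda>m. \<Prod>i<N. c i ^ m i) ` ({..<N} \<rightarrow>\<^sub>E {..n})"
      using \<open>\<And>w. w \<in> {..<n} \<rightarrow>\<^sub>E {..<N} \<Longrightarrow> ratio w n = (\<Prod>i<N. c i ^ occ w i)\<close> by blast
  qed
  then have "card ((\<lambda>w. ratio w n) ` ({..<n} \<rightarrow>\<^sub>E {..<N})) \<le> card ({..<N} \<rightarrow>\<^sub>E {..n})"
    by (intro surj_card_le finite_PiE) auto
  then show ?thesis by (simp add: card_PiE)
qed

text \<open>The weights \<open>ratio w n powr s\<close> sum to 1 over at most
  \<open>(n + 1) ^ N\<close> ratio classes, so some class has weight at least
  \<open>1 / (n + 1) ^ N\<close>. Lowering the exponent from \<open>s\<close> to \<open>t\<close>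
  gains an exponential factor that beats this polynomial.\<close>

lemma ex_homogeneous_words:
  assumes s: "(\<Sum>i<N. c i powr s) = 1" and t: "0 < t" "t < s"
  obtains n W \<rho> where "W \<subseteq> {..<n} \<rightarrow>\<^sub>E {..<N}" "0 < \<rho>" "\<rho> < 1" "\<And>w. w \<in> W \<Longrightarrow> ratio w n = \<rho>"
    "\<rho> powr (- t) \<le> real (card W)"
proof -
  obtain q where q: "0 < q" "q < 1" "\<And>i. i < N \<Longrightarrow> c i \<le> q" using ex_max_ratio by blast
  define x where "x = q powr (s - t)"
  have x: "0 < x" "x < 1" using q t powr_less_mono'[of q 0 "s - t"] by (auto simp: x_def)
  have "(\<lambda>n. x ^ n * (real n + 1) ^ N) \<longlonglongrightarrow> 0" using x by real_asymp
  then have "\<forall>\<^sub>F n in sequentially. x ^ n * (real n + 1) ^ N < 1"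
    by (rule order_tendstoD(2)) simp
  \<comment> \<open>\<open>n > 0\<close> ensures that the common ratio is strictly below 1.\<close>
  then have "\<forall>\<^sub>F n in sequentially. x ^ n * (real n + 1) ^ N < 1 \<and> n > 0"
    using eventually_gt_at_top by (rule eventually_conj)
  then obtain n where n: "x ^ n * (real n + 1) ^ N < 1" "n > 0"
    by (metis (mono_tags, lifting) eventually_sequentially order.refl)
  define Wd where "Wd = {..<n} \<rightarrow>\<^sub>E {..<N}"
  define R where "R = (\<lambda>w. ratio w n) ` Wd"
  define W where "W v = {w \<in> Wd. ratio w n = v}" for v
  have fin: "finite Wd" "finite R" by (auto simp: Wd_def R_def intro: finite_PiE)
  have "1 = (\<Sum>w\<in>Wd. ratio w n powr s)" using sum_ratio_powr[OF s] by (simp add: Wd_def)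
  also have "\<dots> = (\<Sum>v\<in>R. \<Sum>w\<in>W v. ratio w n powr s)"
    unfolding R_def W_def by (rule sum.image_gen[OF fin(1)])
  also have "\<dots> = (\<Sum>v\<in>R. real (card (W v)) * v powr s)"
    by (intro sum.cong refl) (simp add: W_def)
  finally have sum1: "(\<Sum>v\<in>R. real (card (W v)) * v powr s) = 1" ..
  have "\<exists>v\<in>R. 1 \<le> real (card (W v)) * v powr s * (real n + 1) ^ N"
  proof (rule ccontr)
    assume "\<not> ?thesis"
    then have less: "real (card (W v)) * v powr s < 1 / (real n + 1) ^ N" if "v \<in> R" for v
      using that by (simp add: not_le field_simps)
    have "R \<noteq> {}" using sum1 by auto
    then have "(\<Sum>v\<in>R. real (card (W v)) * v powr s) < (\<Sum>v\<in>R. 1 / (real n + 1) ^ N)"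
      using fin less by (intro sum_strict_mono) auto
    then have "1 < (\<Sum>v\<in>R. 1 / (real n + 1) ^ N)" unfolding sum1 .
    also have "\<dots> = real (card R) / (real n + 1) ^ N" by simp
    also have "real (card R) \<le> (real n + 1) ^ N"
      using card_ratios_le[of n] unfolding R_def Wd_def
      by (metis (no_types, lifting) of_nat_1 of_nat_add of_nat_mono of_nat_power)
    then have "real (card R) / (real n + 1) ^ N \<le> 1" by simp
    finally show False by simp
  qed
  then obtain v where v: "v \<in> R" "1 \<le> real (card (W v)) * v powr s * (real n + 1) ^ N" by blast
  obtain w where w: "w \<in> Wd" "v = ratio w n" using v(1) by (auto simp: R_def)
  then have wN: "w k < N" if "k < n" for k using that by (auto simp: Wd_def)
  have "0 < v" using w wN by (auto intro: ratio_pos)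
  have vq: "v \<le> q ^ n" using w wN q(3) by (auto intro: ratio_le_power)
  have "q ^ n < 1" using q n(2) by (simp add: power_less_one_iff)
  with vq have "v < 1" by simp
  have "v powr (s - t) \<le> (q ^ n) powr (s - t)" using vq \<open>0 < v\<close> t by (intro powr_mono2) auto
  also have "\<dots> = x ^ n"
    using q by (simp add: x_def powr_powr mult.commute flip: powr_realpow)
  finally have "v powr (s - t) * (real n + 1) ^ N \<le> x ^ n * (real n + 1) ^ N"
    by (intro mult_right_mono) auto
  with n(1) have le: "v powr (s - t) * (real n + 1) ^ N \<le> 1" by linarith
  have "v powr s = v powr t * v powr (s - t)" by (simp flip: powr_add)
  then have "1 \<le> real (card (W v)) * v powr t * (v powr (s - t) * (real n + 1) ^ N)"
    using v(2) by (simp only: mult.assoc)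
  also have "\<dots> \<le> real (card (W v)) * v powr t * 1"
    using le by (intro mult_left_mono) auto
  finally have "v powr (- t) \<le> real (card (W v))"
    using \<open>0 < v\<close> by (simp add: powr_minus field_simps)
  with \<open>0 < v\<close> \<open>v < 1\<close> show thesis
    by (intro that[of "W v" n v]) (auto simp: W_def Wd_def)
qed

section \<open>Upper bound for the dimension of the attractor\<close>

text \<open>Words with independent letters of weights \<open>c i powr s\<close> have probability
  \<open>ratio w n powr s\<close>. Mixing over the lengths gives an atomic measure with the lower
  mass bound at every point of \<open>K\<close>.\<close>

lemma packing_dim_attractor_le:
  assumes K: "K = (\<Union>i<N. f i ` K)" and s: "0 \<le> s" "(\<Sum>i<N. c i powr s) = 1"
  shows "packing_dim K \<le> ereal s"
proof -
  define h where "h i = (if i < N then c i powr s else 0)" for i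
  define d where "d = embed_pmf h"
  have "0 \<le> h i" for i by (simp add: h_def)
  moreover have "(\<integral>\<^sup>+i. ennreal (h i) \<partial>count_space UNIV) = 1"
  proof -
    have "(\<integral>\<^sup>+i. ennreal (h i) \<partial>count_space UNIV) = (\<Sum>i<N. ennreal (h i))"
      by (intro nn_integral_count_space') (auto simp: h_def)
    also have "\<dots> = ennreal (\<Sum>i<N. h i)" by (intro sum_ennreal) (simp add: h_def)
    finally show ?thesis using s by (simp add: h_def)
  qed
  ultimately have d: "pmf d i = h i" for i unfolding d_def by (rule pmf_embed_pmf)
  have N: "0 < N" using s(2) by (cases N) auto
  define P where "P = bind_pmf heavy_pmf (\<lambda>n. level_pmf n (\<lambda>_. d))"
  \<comment> \<open>\<open>\<kappa>\<close> bounds the drop between consecutive scales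
    \<open>ratio \<omega> n\<close>, uniformly in the coding.\<close>
  define \<kappa> where "\<kappa> = Min (c ` {..<N})"
  have \<kappa>: "0 < \<kappa>" "\<And>i. i < N \<Longrightarrow> \<kappa> \<le> c i"
    using c N by (auto simp: \<kappa>_def Min_gr_iff lessThan_empty_iff)
  obtain q where q: "0 < q" "q < 1" "\<And>i. i < N \<Longrightarrow> c i \<le> q" using ex_max_ratio by blast
  have "lower_mass_bound (pmf_borel P) s x" if x: "x \<in> K" for x
  proof -
    obtain \<omega> where \<omega>: "\<And>k. \<omega> k < N" "\<And>n. x \<in> cm \<omega> n ` K" using ex_coding[OF K x] by blast
    have pos: "0 < ratio \<omega> n" and le: "ratio \<omega> n \<le> q ^ n" for n
      using \<omega>(1) q(3) by (auto intro: ratio_pos ratio_le_power)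
    have mass: "pmf heavy_pmf n * ratio \<omega> n powr s \<le> measure (pmf_borel P) (cball x (D * ratio \<omega> n))" for n
    proof -
      obtain y where y: "y \<in> K" "x = cm \<omega> n y" using \<omega>(2) by auto
      then have "dist (cm \<omega> n base) x \<le> D * ratio \<omega> n"
        using dist_cm[of n \<omega> base y] \<omega>(1) pos[of n] dist_le_D[OF base_in_K y(1)] by (simp add: mult.commute)
      then have "(\<Prod>k<n. pmf d (\<omega> k)) \<le> measure (level_pmf n (\<lambda>_. d)) (cball x (D * ratio \<omega> n))"
        using \<omega>(1) by (intro measure_level_pmf_ge)
      moreover have "(\<Prod>k<n. pmf d (\<omega> k)) = ratio \<omega> n powr s"
        unfolding ratio_def using \<omega>(1) c by (subst prod_powr_distrib) (auto simp: d h_def less_imp_le)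
      ultimately have "pmf heavy_pmf n * ratio \<omega> n powr s \<le>
          pmf heavy_pmf n * measure (level_pmf n (\<lambda>_. d)) (cball x (D * ratio \<omega> n))"
        by (intro mult_left_mono) auto
      also have "\<dots> \<le> measure P (cball x (D * ratio \<omega> n))"
        unfolding P_def by (rule measure_bind_pmf_ge)
      finally show ?thesis by (simp add: measure_pmf_borel)
    qed
    show ?thesis
    proof (rule lower_mass_boundI_scales[where a = "ratio \<omega>" and \<kappa> = \<kappa> and B = D])
      have "(\<lambda>n. q ^ n) \<longlonglongrightarrow> 0" using q by (intro LIMSEQ_realpow_zero) auto
      then show "ratio \<omega> \<longlonglongrightarrow> 0"
        by (rule Lim_null_comparison[rotated]) (use pos le in \<open>auto simp: less_imp_le abs_of_pos\<close>)
      show "\<kappa> * ratio \<omega> n \<le> ratio \<omega> (Suc n)" for n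
        using \<kappa>(2)[OF \<omega>(1), of n] pos[of n] by (simp add: ratio_def mult.commute)
      fix \<epsilon> :: real assume "\<epsilon> > 0"
      then have "0 < q powr \<epsilon>" "q powr \<epsilon> < 1" using q powr_less_mono'[of q 0 \<epsilon>] by auto
      from pmf_heavy_ge_power[OF this]
      show "\<forall>\<^sub>F n in sequentially. ratio \<omega> n powr (s + \<epsilon>) \<le> measure (pmf_borel P) (cball x (D * ratio \<omega> n))"
      proof eventually_elim
        case (elim n)
        have "ratio \<omega> n powr \<epsilon> \<le> (q ^ n) powr \<epsilon>"
          using pos[of n] le[of n] \<open>\<epsilon> > 0\<close> by (intro powr_mono2) auto
        also have "\<dots> = (q powr \<epsilon>) ^ n" using q by (simp add: powr_powr mult.commute flip: powr_realpow)
        also note elim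
        finally have "ratio \<omega> n powr \<epsilon> * ratio \<omega> n powr s \<le> pmf heavy_pmf n * ratio \<omega> n powr s"
          by (intro mult_right_mono) auto
        with mass[of n] show ?case by (simp add: powr_add mult.commute)
      qed
    qed (use pos \<kappa>(1) D_pos s(1) finite_measure_pmf_borel in auto)
  qed
  then show ?thesis
    by (intro packing_dim_le[where \<mu> = "pmf_borel P"] finite_measure_pmf_borel s(1)) auto
qed

end

text \<open>Words of one common ratio form a homogeneous system on the same \<open>K\<close> and
  \<open>V\<close>. Having at least \<open>\<rho> powr (- t)\<close> of them makes its similarity
  dimension at least \<open>t\<close>.\<close>

lemma (in osc_ifs) ex_diagonal_pmf:
  assumes s: "(\<Sum>i<N. c i powr s) = 1" and "t < s"
  shows "\<exists>P. set_pmf P \<subseteq> K \<and> (\<forall>\<alpha>. 0 < \<alpha> \<and> \<alpha> < t \<longrightarrow> diagonal_mass K P \<alpha>)"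
proof (cases "0 < t")
  case False
  \<comment> \<open>For \<open>t \<le> 0\<close> no exponent is asked for, and any pmf on
    \<open>K\<close> serves.\<close>
  then show ?thesis by (intro exI[of _ "return_pmf base"]) (auto simp: base_in_K)
next
  case True
  then obtain n W \<rho> where W: "W \<subseteq> {..<n} \<rightarrow>\<^sub>E {..<N}" and \<rho>: "0 < \<rho>" "\<rho> < 1"
      and ratio: "\<And>w. w \<in> W \<Longrightarrow> ratio w n = \<rho>" and cW: "\<rho> powr (- t) \<le> real (card W)"
    using ex_homogeneous_words[OF s True \<open>t < s\<close>] by metis
  define N' where "N' = card W"
  have "finite W" using W by (rule finite_subset) (auto intro: finite_PiE)
  then obtain h where h: "bij_betw h {..<N'} W"
    using ex_bij_betw_nat_finite[of W] by (auto simp: N'_def atLeast0LessThan)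
  have hW: "h i \<in> W" if "i < N'" for i using h that by (auto simp: bij_betw_def)
  then have hN: "h i k < N" if "i < N'" "k < n" for i k
    using W that by (auto simp: PiE_iff subset_iff)
  define g where "g i = (if i < N' then cm (h i) n else id)" for i
  have g_dist: "dist (g i x) (g i y) = \<rho> * dist x y" if "i < N'" for i x y
    using that hN hW ratio by (simp add: g_def dist_cm)
  interpret sub: osc_ifs g N' "\<lambda>_. \<rho>" K V
  proof
    show "g i ` K \<subseteq> K" if "i < N'" for i
      using that hN cm_in_K by (auto simp: g_def)
    show "g i ` V \<subseteq> V" if "i < N'" for i
      using that hN cm_V by (simp add: g_def)
    show "g i ` V \<inter> g j ` V = {}" if "i < N'" "j < N'" "i \<noteq> j" for i j
    proof -
      have "h i \<noteq> h j" using h that by (auto simp: bij_betw_def inj_on_def)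
      then have "\<exists>k<n. h i k \<noteq> h j k"
        using PiE_ext[of "h i" "{..<n}" "\<lambda>_. {..<N}" "h j"] hW that W by (metis lessThan_iff subset_iff)
      then show ?thesis using that hN by (simp add: g_def cm_V_disjoint)
    qed
  qed (use \<rho> g_dist compact_K K_nonempty open_V V_nonempty in auto)
  have meas: "g i \<in> borel_measurable borel" for i
  proof (cases "i < N'")
    case True
    have "continuous_on UNIV (g i)"
      unfolding continuous_on_iff
    proof (intro ballI allI impI)
      fix x :: 'a and e :: real assume "e > 0"
      then show "\<exists>d>0. \<forall>x'\<in>UNIV. dist x' x < d \<longrightarrow> dist (g i x') (g i x) < e"
        using \<rho> by (intro exI[of _ "e / \<rho>"]) (auto simp: g_dist[OF True] field_simps)
    qed
    then show ?thesis by (rule borel_measurable_continuous_onI)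
  next
    case False
    then have "g i = (\<lambda>x. x)" by (simp add: g_def fun_eq_iff)
    then show ?thesis by simp
  qed
  \<comment> \<open>The solution of \<open>N' * \<rho> powr \<sigma> = 1\<close>.\<close>
  define \<sigma> where "\<sigma> = - ln (real N') / ln \<rho>"
  have "1 < \<rho> powr (- t)" using \<rho> True powr_less_mono'[of \<rho> "- t" 0] by simp
  then have "1 < real N'" using cW by (simp add: N'_def)
  have ln: "ln \<rho> < 0" using \<rho> by simp
  have "\<sigma> * ln \<rho> = - ln (real N')" using ln by (simp add: \<sigma>_def)
  then have "\<rho> powr \<sigma> = 1 / real N'"
    using \<rho> \<open>1 < real N'\<close> by (simp add: powr_def exp_minus inverse_eq_divide)
  then have \<sigma>1: "real N' * \<rho> powr \<sigma> = 1" using \<open>1 < real N'\<close> by simp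
  have "1 / real N' \<le> 1 / \<rho> powr (- t)"
    using cW \<rho> \<open>1 < real N'\<close> by (intro divide_left_mono) (auto simp: N'_def)
  then have "\<rho> powr \<sigma> \<le> \<rho> powr t"
    using \<open>\<rho> powr \<sigma> = 1 / real N'\<close> by (simp add: powr_minus inverse_eq_divide)
  then have "t \<le> \<sigma>" using \<rho> powr_less_mono'[of \<rho> \<sigma> t] by (meson not_less)
  then have "0 < \<sigma>" using True by simp
  from sub.homogeneous_diagonal_pmf[OF \<rho> refl meas this \<sigma>1] \<open>t \<le> \<sigma>\<close>
  show ?thesis by (meson less_le_trans)
qed

section \<open>Countable mixtures and the transfer to \<open>K\<close>\<close>

text \<open>The factor \<open>h\<close> is absorbed by \<open>r powr (\<epsilon> / 2)\<close>; this
  lets a mixture inherit the bounds of its components.\<close>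

lemma lower_mass_bound_mono:
  assumes "0 < h" and le: "\<And>r. h * measure \<mu> (cball x r) \<le> measure \<mu>' (cball x r)"
    and "lower_mass_bound \<mu> \<alpha> x"
  shows "lower_mass_bound \<mu>' \<alpha> x"
  unfolding lower_mass_bound_def
proof (intro allI impI)
  fix \<epsilon> :: real assume "\<epsilon> > 0"
  then have "\<forall>\<^sub>F r in at_right 0. r powr (\<alpha> + \<epsilon> / 2) \<le> measure \<mu> (cball x r)"
    using assms(3) by (simp add: lower_mass_bound_def)
  moreover have "((\<lambda>r::real. r powr (\<epsilon> / 2)) \<longlongrightarrow> 0 powr (\<epsilon> / 2)) (at_right 0)"
    using \<open>\<epsilon> > 0\<close> by (intro tendsto_powr') (auto intro!: eventually_at_rightI[of 0 1])
  then have "\<forall>\<^sub>F r in at_right 0. r powr (\<epsilon> / 2) < h"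
    using \<open>h > 0\<close> by (intro order_tendstoD(2)[where y = 0]) auto
  ultimately show "\<forall>\<^sub>F r in at_right 0. r powr (\<alpha> + \<epsilon>) \<le> measure \<mu>' (cball x r)"
  proof eventually_elim
    case (elim r)
    have "r powr (\<alpha> + \<epsilon>) = r powr (\<epsilon> / 2) * r powr (\<alpha> + \<epsilon> / 2)" by (simp add: add.commute flip: powr_add)
    also have "\<dots> \<le> h * measure \<mu> (cball x r)" using elim \<open>h > 0\<close> by (intro mult_mono) auto
    finally show ?case using le[of r] by linarith
  qed
qed

lemma diagonal_mass_bind:
  assumes "diagonal_mass K (F i) \<alpha>" "i \<in> set_pmf M"
  shows "diagonal_mass K (bind_pmf M F) \<alpha>"
proof -
  have mono: "lower_mass_bound (pmf_borel (bind_pmf M F)) \<alpha> x" if "lower_mass_bound (pmf_borel (F i)) \<alpha> x" for x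
    using pmf_positive[OF assms(2)] _ that
    by (rule lower_mass_bound_mono) (simp add: measure_pmf_borel measure_bind_pmf_ge)
  obtain \<Omega> :: "(nat \<Rightarrow> nat) measure" and \<pi> where
    \<Omega>: "prob_space \<Omega>" "\<pi> \<in> borel_measurable \<Omega>" "frostman (distr \<Omega> borel \<pi>) \<alpha>"
    and AE: "AE \<omega> in \<Omega>. \<pi> \<omega> \<in> K \<and> lower_mass_bound (pmf_borel (F i)) \<alpha> (\<pi> \<omega>)"
    using assms(1) unfolding diagonal_mass_def by blast
  from AE have "AE \<omega> in \<Omega>. \<pi> \<omega> \<in> K \<and> lower_mass_bound (pmf_borel (bind_pmf M F)) \<alpha> (\<pi> \<omega>)"
    by eventually_elim (use mono in blast)
  with \<Omega> show ?thesis unfolding diagonal_mass_def by blast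
qed

text \<open>The upper mass bound holds almost surely for any Frostman measure of this exponent, so
  the random point lies in \<open>A\<close> almost surely and the mass distribution principle
  applies.\<close>

lemma diagonal_mass_hausdorff_dim:
  fixes P :: "'a::euclidean_space pmf"
  assumes P: "diagonal_mass K P \<alpha>" and "0 < \<alpha>"
    and A: "\<And>x. x \<in> K \<Longrightarrow> lower_mass_bound (pmf_borel P) \<alpha> x \<Longrightarrow> upper_mass_bound (pmf_borel P) \<alpha> x \<Longrightarrow> x \<in> A"
  shows "ereal \<alpha> \<le> hausdorff_dim A"
proof -
  obtain \<Omega> :: "(nat \<Rightarrow> nat) measure" and \<pi> where "prob_space \<Omega>" and \<pi>: "\<pi> \<in> borel_measurable \<Omega>"
     and fr: "frostman (distr \<Omega> borel \<pi>) \<alpha>"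
     and AE: "AE \<omega> in \<Omega>. \<pi> \<omega> \<in> K \<and> lower_mass_bound (pmf_borel P) \<alpha> (\<pi> \<omega>)"
    using P unfolding diagonal_mass_def by blast
  interpret prob_space \<Omega> by fact
  have "AE \<omega> in \<Omega>. upper_mass_bound (pmf_borel P) \<alpha> (\<pi> \<omega>)"
    using frostman_AE_upper_mass_bound[OF fr finite_measure_pmf_borel[of P] _ \<open>0 < \<alpha>\<close>] by (intro AE_distrD[OF \<pi>]) simp
  with AE have A': "AE \<omega> in \<Omega>. \<pi> \<omega> \<in> A" by eventually_elim (use A in blast)
  show ?thesis
  proof (rule mass_distribution_principle[OF fr])
    fix B :: "'a set" assume B: "B \<in> sets borel" "A \<subseteq> B"
    have "emeasure (distr \<Omega> borel \<pi>) B = emeasure \<Omega> (\<pi> -` B \<inter> space \<Omega>)"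
      using \<pi> B by (intro emeasure_distr)
    also have "\<dots> = 1"
    proof (rule emeasure_eq_1_AE)
      show "\<pi> -` B \<inter> space \<Omega> \<in> sets \<Omega>" by (rule measurable_sets[OF \<pi> B(1)])
      show "AE \<omega> in \<Omega>. \<omega> \<in> \<pi> -` B \<inter> space \<Omega>"
        using A' AE_space by eventually_elim (use B in blast)
    qed
    finally show "emeasure (distr \<Omega> borel \<pi>) B = 1" .
  qed
qed

text \<open>\<open>P\<close> is carried by \<open>K\<close>, so restriction keeps total mass 1 and
  changes no ball mass; this links the measure on \<open>K\<close> with the one on the whole
  space.\<close>

lemma restrict_pmf_borel:
  fixes P :: "'a::metric_space pmf"
  assumes "set_pmf P \<subseteq> K" "K \<in> sets borel"
  shows "restrict_space (pmf_borel P) K \<in> borel_prob_measures K"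
    and "space (restrict_space (pmf_borel P) K) = K"
    and "measure (restrict_space (pmf_borel P) K) (cball x r \<inter> space (restrict_space (pmf_borel P) K)) =
         measure (pmf_borel P) (cball x r)"
proof -
  have "emeasure (pmf_borel P) K = emeasure P K" using assms by (subst emeasure_distr) auto
  also have "\<dots> = 1" using assms by (intro measure_pmf.emeasure_eq_1_AE) (auto intro!: AE_pmfI)
  finally have "prob_space (restrict_space (pmf_borel P) K)"
    using assms by (intro prob_space_restrict_space) auto
  moreover have "sets (restrict_space (pmf_borel P) K) = sets (restrict_space borel K)"
    by (intro sets_restrict_space_cong) simp
  ultimately show "restrict_space (pmf_borel P) K \<in> borel_prob_measures K"
    unfolding borel_prob_measures_def space_prob_algebra by simp
  show sp: "space (restrict_space (pmf_borel P) K) = K" by (simp add: space_restrict_space)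
  have "measure (restrict_space (pmf_borel P) K) (cball x r \<inter> K) = measure (pmf_borel P) (cball x r \<inter> K)"
    using assms by (intro measure_restrict_space) auto
  also have "\<dots> = measure P (cball x r \<inter> K)" using assms by (simp add: measure_pmf_borel)
  also have "\<dots> = measure P (cball x r)"
    using assms by (intro measure_pmf.finite_measure_eq_AE) (auto intro!: AE_pmfI)
  finally show "measure (restrict_space (pmf_borel P) K) (cball x r \<inter> space (restrict_space (pmf_borel P) K)) =
         measure (pmf_borel P) (cball x r)"
    by (simp add: sp measure_pmf_borel)
qed

theorem corollary1p6:
  fixes K :: "(real ^ 'd) set" and S :: "nat \<Rightarrow> real ^ 'd \<Rightarrow> real ^ 'd" and m :: nat
    and s :: ereal
  assumes "self_similar_by m S K"
    and "open_set_condition m S"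
    and "s = hausdorff_dim K"
  shows "s = packing_dim K \<and>
    (\<exists>\<mu>\<in>borel_prob_measures K. \<forall>\<alpha>::real. 0 < ereal \<alpha> \<and> ereal \<alpha> < s \<longrightarrow>
       hausdorff_dim (local_dim_level_set \<mu> \<alpha>) = ereal \<alpha> \<and>
       packing_dim (local_dim_level_set \<mu> \<alpha>) = ereal \<alpha>)"
proof -
  have K: "compact K" "K \<noteq> {}" "K = (\<Union>i<m. S i ` K)" and sim: "\<And>i. i < m \<Longrightarrow> contractive_similarity (S i)"
    using assms(1) by (auto simp: self_similar_by_def)
  obtain V where V: "open V" "V \<noteq> {}" "\<And>i. i < m \<Longrightarrow> S i ` V \<subseteq> V"
      "\<And>i j. i < m \<Longrightarrow> j < m \<Longrightarrow> i \<noteq> j \<Longrightarrow> S i ` V \<inter> S j ` V = {}"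
    using assms(2) unfolding open_set_condition_def by metis
  have "\<exists>c>0. c < 1 \<and> (\<forall>x y. dist (S i x) (S i y) = c * dist x y)" if "i < m" for i
    using sim[OF that] by (auto simp: contractive_similarity_def)
  then obtain c where c: "\<And>i. i < m \<Longrightarrow> 0 < c i \<and> c i < 1"
     "\<And>i x y. i < m \<Longrightarrow> dist (S i x) (S i y) = c i * dist x y" by metis
  have SK: "S i ` K \<subseteq> K" if "i < m" for i using that by (subst (2) K(3)) blast
  interpret osc_ifs S m c K V
    by unfold_locales (use c K(1,2) SK V in auto)
  have "0 < m" using K by (cases m) auto
  then obtain \<sigma> where \<sigma>: "0 \<le> \<sigma>" "(\<Sum>i<m. c i powr \<sigma>) = 1" using ex_similarity_dim by metis
  \<comment> \<open>One pmf serves only exponents below a fixed bound less than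
    \<open>\<sigma>\<close>; the bounds \<open>\<sigma> - 1 / Suc k\<close> exhaust all exponents
    below \<open>\<sigma>\<close>.\<close>
  have "\<exists>P. set_pmf P \<subseteq> K \<and> (\<forall>\<alpha>. 0 < \<alpha> \<and> \<alpha> < \<sigma> - 1 / real (Suc k) \<longrightarrow> diagonal_mass K P \<alpha>)" for k
    by (rule ex_diagonal_pmf[OF \<sigma>(2)]) simp
  then obtain F where F: "\<And>k. set_pmf (F k) \<subseteq> K"
      "\<And>k \<alpha>. 0 < \<alpha> \<Longrightarrow> \<alpha> < \<sigma> - 1 / real (Suc k) \<Longrightarrow> diagonal_mass K (F k) \<alpha>" by metis
  define P where "P = bind_pmf heavy_pmf F"
  have PK: "set_pmf P \<subseteq> K" using F(1) by (auto simp: P_def)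
  have P: "diagonal_mass K P \<alpha>" if \<alpha>: "0 < \<alpha>" "\<alpha> < \<sigma>" for \<alpha>
  proof -
    obtain k where "1 / real (Suc k) < \<sigma> - \<alpha>" using nat_approx_posE[of "\<sigma> - \<alpha>"] \<alpha> by auto
    then have "diagonal_mass K (F k) \<alpha>" using F(2) \<alpha> by simp
    moreover have "k \<in> set_pmf heavy_pmf" by (simp add: set_pmf_iff pmf_heavy)
    ultimately show ?thesis unfolding P_def by (rule diagonal_mass_bind)
  qed
  have upper: "packing_dim K \<le> ereal \<sigma>" using K(3) \<sigma> by (rule packing_dim_attractor_le)
  \<comment> \<open>The diagonal measures exist only below \<open>\<sigma>\<close>, so exponent
    \<open>\<sigma> - e\<close> is applied with \<open>K\<close> itself as the target set;
    \<open>\<sigma> \<le> e\<close> needs only nonnegativity.\<close>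
  have "ereal \<sigma> \<le> hausdorff_dim K"
  proof (rule ereal_le_epsilon2)
    fix e :: real assume "0 < e"
    have nonneg: "0 \<le> hausdorff_dim K" unfolding hausdorff_dim_def by (intro INF_greatest) auto
    show "ereal \<sigma> \<le> hausdorff_dim K + ereal e"
    proof (cases "\<sigma> \<le> e")
      case True
      then have "ereal \<sigma> \<le> 0 + ereal e" by simp
      also have "\<dots> \<le> hausdorff_dim K + ereal e" using nonneg by (intro add_right_mono)
      finally show ?thesis .
    next
      case False
      then have "ereal (\<sigma> - e) \<le> hausdorff_dim K"
        using P[of "\<sigma> - e"] \<open>0 < e\<close> by (intro diagonal_mass_hausdorff_dim[of K P]) auto
      then have "ereal (\<sigma> - e) + ereal e \<le> hausdorff_dim K + ereal e" by (rule add_right_mono)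
      then show ?thesis by simp
    qed
  qed
  then have dims: "hausdorff_dim K = ereal \<sigma>" "packing_dim K = ereal \<sigma>"
    using upper hausdorff_dim_le_packing_dim[of K] by (metis order.antisym order.trans)+
  have "K \<in> sets borel" using compact_imp_closed[OF K(1)] by simp
  note R = restrict_pmf_borel[OF PK this]
  define E where "E \<alpha> = local_dim_level_set (restrict_space (pmf_borel P) K) \<alpha>" for \<alpha>
  have E: "E \<alpha> = {x \<in> K. lower_mass_bound (pmf_borel P) \<alpha> x \<and> upper_mass_bound (pmf_borel P) \<alpha> x}" for \<alpha>
    unfolding E_def by (subst local_dim_level_set_eq[OF R(3)]) (simp only: R(2))
  have "hausdorff_dim (E \<alpha>) = ereal \<alpha> \<and> packing_dim (E \<alpha>) = ereal \<alpha>" if "0 < \<alpha>" "\<alpha> < \<sigma>" for \<alpha>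
  proof -
    \<comment> \<open>The upper mass bound in \<open>E\<close> comes from the Frostman measure and
      is used here; the lower one alone bounds the packing dimension. The Hausdorff dimension being
      at most the packing dimension closes the chain.\<close>
    have "ereal \<alpha> \<le> hausdorff_dim (E \<alpha>)"
      using P[OF that] that(1) by (rule diagonal_mass_hausdorff_dim) (simp add: E)
    moreover have "packing_dim (E \<alpha>) \<le> ereal \<alpha>"
      using that(1) by (intro packing_dim_le[where \<mu> = "pmf_borel P"] finite_measure_pmf_borel) (auto simp: E)
    ultimately show ?thesis
      using hausdorff_dim_le_packing_dim[of "E \<alpha>"] by (meson order.antisym order.trans)
  qed
  then show ?thesis
    using R(1) dims assms(3) unfolding E_def by (auto intro!: bexI[of _ "restrict_space (pmf_borel P) K"])
qed

end
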